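(* Consider the \textsc{Max} problem in the noisy comparison model. Let $X$ be a set of $n$ elements, let $r$ be an integer and let $\delta\in[1/n^8,1]$. Let $b$ be defined by $r=\log_b^*(n)+4$. Then there is an algorithm ($\mathbf{ParallelMax}(X,r,\delta)$) which returns a maximum element of $X$ with correctness probability at least $1-\delta$, has round complexity $r$, and has query complexity $q=O(n\log(b/\delta))$.
   Context: Each element has a (real) value; several elements may share a value, and a maximum element is any element of largest value. Noisy comparison model: the algorithm accesses the elements only through queries of the form ``is the value of element $x$ greater than or equal to the value of element $y$?''; for each query, with probability $2/3$ the oracle returns the correct answer, and with the remaining probability it returns an arbitrary (adversarial) answer. The query complexity is the total number of queries. An algorithm has round complexity $r$ if its queries can be partitioned into a sequence of $r$ batches, where the queries of a batch only depend on the answers received for the previous batches. For $b>1$, $\log_b^*(n)$ is the least integer $i$ such that $a_i\le 0$ in the sequence $a_0=n$, $a_{j+1}=\log_b a_j$. *)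

theory Defs
  imports "HOL-Probability.Probability" "HOL-Library.Extended_Nat"
begin

(* The value is \<infinity> when the iteration never reaches a nonpositive number, which happens
   for instance when n \<ge> 3 and b \<le> exp (1 / exp 1). Taking the least index makes the totalised
   value of log on nonpositive arguments irrelevant. *)
definition log_star :: "real \<Rightarrow> real \<Rightarrow> enat" where
  "log_star b x = (INF i \<in> {i. (log b ^^ i) x \<le> 0}. enat i)"

lemma log_star_eq_enat_iff:
  "log_star b x = enat k \<longleftrightarrow> (log b ^^ k) x \<le> 0 \<and> (\<forall>i<k. (log b ^^ i) x > 0)"
proof
  assume k: "log_star b x = enat k"
  then have "{i. (log b ^^ i) x \<le> 0} \<noteq> {}"
    by (metis INF_empty enat.distinct(1) log_star_def top_enat_def)
  then have "log_star b x \<in> enat ` {i. (log b ^^ i) x \<le> 0}"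
    unfolding log_star_def by (auto intro: wellorder_InfI)
  moreover have "enat k \<le> enat i" if "(log b ^^ i) x \<le> 0" for i
    using that k[symmetric] by (auto simp: log_star_def intro: INF_lower)
  ultimately show "(log b ^^ k) x \<le> 0 \<and> (\<forall>i<k. (log b ^^ i) x > 0)"
    using k by (auto simp: not_le[symmetric])
next
  assume "(log b ^^ k) x \<le> 0 \<and> (\<forall>i<k. (log b ^^ i) x > 0)"
  then show "log_star b x = enat k"
    unfolding log_star_def
    by (intro antisym INF_lower INF_greatest) (auto simp: not_less[symmetric])
qed

(* The query (x, y) asks whether the value of x is greater than or equal to the value of y.
   A transcript lists the batches in chronological order, each query with the answer received. *)
type_synonym 'a query = "'a \<times> 'a"
type_synonym 'a transcript = "('a query \<times> bool) list list"

(* A randomised algorithm working in rounds. Element values are not an argument: the transcript is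
   the only information about them. Drawing every batch with fresh randomness given the transcript
   loses no generality over an algorithm with private random state. Batches may be empty. *)
record 'a algorithm =
  rounds :: nat
  next_batch :: "'a transcript \<Rightarrow> 'a query list pmf"
  final_output :: "'a transcript \<Rightarrow> 'a pmf"

(* adv h qs cs i is the answer given to the i-th query of the batch qs if that query is corrupted.
   It may depend on the earlier transcript h, on the whole current batch and on which of its
   queries are corrupted (cs), and, as the adversary is chosen after the values, on the values. *)
type_synonym 'a adversary = "'a transcript \<Rightarrow> 'a query list \<Rightarrow> bool list \<Rightarrow> nat \<Rightarrow> bool"

definition correct_answer :: "('a \<Rightarrow> real) \<Rightarrow> 'a query \<Rightarrow> bool" where
  "correct_answer v q \<longleftrightarrow> v (fst q) \<ge> v (snd q)"

definition answer_batch ::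
    "('a \<Rightarrow> real) \<Rightarrow> 'a adversary \<Rightarrow> 'a transcript \<Rightarrow> 'a query list \<Rightarrow> bool list \<Rightarrow> ('a query \<times> bool) list"
  where
  "answer_batch v adv h qs cs =
     map (\<lambda>i. (qs ! i, if cs ! i then correct_answer v (qs ! i) else adv h qs cs i)) [0..<length qs]"

primrec run_rounds ::
    "'a algorithm \<Rightarrow> ('a \<Rightarrow> real) \<Rightarrow> 'a adversary \<Rightarrow> nat \<Rightarrow> 'a transcript pmf" where
  "run_rounds A v adv 0 = return_pmf []"
| "run_rounds A v adv (Suc k) =
     bind_pmf (run_rounds A v adv k) (\<lambda>h.
     bind_pmf (next_batch A h) (\<lambda>qs.
     bind_pmf (replicate_pmf (length qs) (bernoulli_pmf (2/3))) (\<lambda>cs.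
     return_pmf (h @ [answer_batch v adv h qs cs]))))"

definition final_transcript :: "'a algorithm \<Rightarrow> ('a \<Rightarrow> real) \<Rightarrow> 'a adversary \<Rightarrow> 'a transcript pmf" where
  "final_transcript A v adv = run_rounds A v adv (rounds A)"

definition result :: "'a algorithm \<Rightarrow> ('a \<Rightarrow> real) \<Rightarrow> 'a adversary \<Rightarrow> 'a pmf" where
  "result A v adv = bind_pmf (final_transcript A v adv) (final_output A)"

definition queries_only :: "'a algorithm \<Rightarrow> 'a set \<Rightarrow> bool" where
  "queries_only A X \<longleftrightarrow>
     (\<forall>v adv. \<forall>h \<in> set_pmf (final_transcript A v adv). \<forall>B \<in> set h. fst ` set B \<subseteq> X \<times> X)"

definition query_complexity_le :: "'a algorithm \<Rightarrow> real \<Rightarrow> bool" where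
  "query_complexity_le A q \<longleftrightarrow>
     (\<forall>v adv. \<forall>h \<in> set_pmf (final_transcript A v adv). real (sum_list (map length h)) \<le> q)"

definition returns_max_with_prob_ge :: "'a algorithm \<Rightarrow> 'a set \<Rightarrow> real \<Rightarrow> bool" where
  "returns_max_with_prob_ge A X p \<longleftrightarrow>
     (\<forall>v adv. measure_pmf.prob (result A v adv) {x. is_arg_max v (\<lambda>y. y \<in> X) x} \<ge> p)"

end

theory Submission
  imports Defs "HOL-Real_Asymp.Real_Asymp"
begin

text \<open>
  Repeating a query \<open>c\<close> times and taking the majority answer errs with probability at most
  \<open>err ^ c\<close> for a constant \<open>err < 1\<close>. The maximum of a random sample of about \<open>n powr (4/10)\<close>
  elements, found by comparing all pairs, is exceeded by only about \<open>n powr (7/10)\<close> elements and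
  serves as a pivot. The remaining elements are compared with the pivot in a series of filter
  rounds: if the non-exceeding elements have been thinned out by a factor \<open>T\<^sup>2\<close>, then the next
  round affords about \<open>T * ln B\<close> repetitions per element, and by Markov's inequality it thins
  them out by the square of \<open>B ^ T\<close>. Hence the factors grow like a tower of \<open>B\<close>'s, and
  \<open>log\<^sup>*\<close> many rounds leave only elements exceeding the pivot. A second sample, one filter round
  and a final comparison of all pairs, all with about \<open>ln n\<close> repetitions, identify the maximum.
\<close>

section \<open>Majority votes over noisy queries\<close>

text \<open>With \<open>g\<close> about the tenth root of \<open>n\<close>, comparing all pairs of
  \<open>g ^ 4\<close> elements about \<open>ln n\<close> times each stays below \<open>n\<close>
  queries, and every sampled element has more than \<open>2 * g ^ 7\<close> elements above it only
  with probability at most \<open>exp (- g)\<close>, far below \<open>1 / n ^ 8\<close>. The four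
  extra rounds are the two samples, the last filter and the final comparison. Thinning by a square
  keeps the total linear: about \<open>n / T ^ 2\<close> elements at
  \<open>T * ln (B / \<delta>)\<close> votes each cost \<open>n * ln (B / \<delta>) / T\<close>, and
  \<open>T\<close> grows at least geometrically. The elements above the pivot are never thinned out;
  they are paid for separately, at about \<open>ln n\<close> votes in each of at most
  \<open>g\<close> active rounds. Two obstacles remain. The algorithm knows \<open>r\<close> but not
  \<open>b\<close>, so a base has to be recovered from \<open>n\<close> and \<open>r\<close>. And
  \<open>ln (b / \<delta>)\<close> must be bounded away from 0 to absorb constants: a finite
  iterated logarithm forces \<open>b > sqrt 2\<close> for \<open>n >= 2\<close>, while
  \<open>n = 1\<close> must be solved without any query.\<close>

lemma prob_bind_pmf_le:
  assumes "measure_pmf.prob M B \<le> e" and "0 \<le> d"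
    and "\<And>x. x \<in> set_pmf M \<Longrightarrow> x \<notin> B \<Longrightarrow> measure_pmf.prob (f x) A \<le> d"
  shows "measure_pmf.prob (bind_pmf M f) A \<le> e + d"
proof -
  have "emeasure (bind_pmf M f) A = (\<integral>\<^sup>+x. emeasure (f x) A \<partial>M)" by simp
  also have "\<dots> \<le> (\<integral>\<^sup>+x. indicator B x + ennreal d \<partial>M)"
  proof (rule nn_integral_mono_AE, rule AE_pmfI)
    fix x assume x: "x \<in> set_pmf M"
    show "emeasure (f x) A \<le> indicator B x + ennreal d"
    proof (cases "x \<in> B")
      case True
      then show ?thesis
        using measure_pmf.emeasure_le_1[of "f x" A] by (simp add: add_increasing2)
    next
      case False
      then show ?thesis
        using assms(3)[OF x] assms(2) by (simp add: measure_pmf.emeasure_eq_measure)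
    qed
  qed
  also have "\<dots> = emeasure M B + ennreal d"
    by (subst nn_integral_add) auto
  also have "\<dots> = ennreal (measure_pmf.prob M B + d)"
    using assms(2) by (simp add: measure_pmf.emeasure_eq_measure)
  also have "\<dots> \<le> ennreal (e + d)"
    using assms(1) by (intro ennreal_leI) simp
  finally show ?thesis
    using assms(1,2) measure_nonneg[of "measure_pmf M" B]
    by (simp add: measure_pmf.emeasure_eq_measure del: ennreal_plus)
qed

text \<open>Markov's inequality. It asks for no independence between elements, which suits an
  adversary who sees the whole batch and may correlate the wrong answers.\<close>

lemma prob_card_gt_le:
  fixes M :: "'b pmf" and P :: "'a \<Rightarrow> 'b \<Rightarrow> bool" and e :: real
  assumes "finite S" and "f > 0" and "\<And>x. x \<in> S \<Longrightarrow> measure_pmf.prob M {w. P x w} \<le> e"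
  shows "measure_pmf.prob M {w. f < real (card {x \<in> S. P x w})} \<le> card S * e / f"
proof -
  define Y where "Y w = (\<Sum>x\<in>S. indicator {w. P x w} w :: real)" for w
  have Y_int: "integrable M Y"
    unfolding Y_def
    by (intro Bochner_Integration.integrable_sum measure_pmf.integrable_const_bound[where B=1]) auto
  have Y_nonneg: "0 \<le> Y w" for w
    by (simp add: Y_def sum_nonneg)
  have card_eq: "real (card {x \<in> S. P x w}) = Y w" for w
    using assms(1) by (simp add: Y_def indicator_def sum.If_cases Int_def)
  have "measure_pmf.prob M {w. f < real (card {x \<in> S. P x w})} \<le> measure_pmf.prob M {w \<in> space M. Y w \<ge> f}"
    by (rule measure_pmf.finite_measure_mono) (auto simp: card_eq)
  also have "\<dots> \<le> measure_pmf.expectation M Y / f"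
    by (rule integral_Markov_inequality_measure[where A = "{}"])
       (use assms(2) Y_int in \<open>auto simp: Y_nonneg\<close>)
  also have "measure_pmf.expectation M Y = (\<Sum>x\<in>S. measure_pmf.prob M {w. P x w})"
    unfolding Y_def
    by (subst Bochner_Integration.integral_sum)
       (auto intro!: measure_pmf.integrable_const_bound[where B=1])
  also have "\<dots> \<le> card S * e"
    using sum_mono[of S "\<lambda>x. measure_pmf.prob M {w. P x w}" "\<lambda>_. e"] assms(3) by simp
  finally show ?thesis using assms(2) by (simp add: divide_right_mono)
qed

lemma prob_replicate_pmf_subset:
  "measure_pmf.prob (replicate_pmf s p) {xs. set xs \<subseteq> A} = measure_pmf.prob p A ^ s"
proof (induction s)
  case (Suc s)
  have "emeasure (replicate_pmf (Suc s) p) {xs. set xs \<subseteq> A}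
      = (\<integral>\<^sup>+x. \<integral>\<^sup>+xs. indicator A x * indicator {xs. set xs \<subseteq> A} xs \<partial>replicate_pmf s p \<partial>p)"
    by (simp add: emeasure_return_pmf) (intro nn_integral_cong, auto simp: indicator_def)
  also have "\<dots> = emeasure p A * emeasure (replicate_pmf s p) {xs. set xs \<subseteq> A}"
    by (simp add: nn_integral_cmult nn_integral_multc)
  finally show ?case
    using Suc by (simp add: measure_pmf.emeasure_eq_measure ennreal_mult''[symmetric])
qed simp

section \<open>Majority votes and their Chernoff bound\<close>

text \<open>Votes are collected by query and not by position, as the copies of a query are spread
  over the batch. A tie reads as \<open>False\<close>; the error bound below counts ties as possible
  errors for either correct answer.\<close>

definition majority :: "('a query \<times> bool) list \<Rightarrow> 'a query \<Rightarrow> bool" where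
  "majority B q \<longleftrightarrow> count_list B (q, False) < count_list B (q, True)"

text \<open>The mean of the Chernoff weight of one vote,
  \<open>2/3 * (1 / sqrt 2) + 1/3 * sqrt 2\<close>. The base \<open>sqrt 2\<close> minimises
  it.\<close>

definition err :: real where "err = 2 * sqrt 2 / 3"

lemma err_pos: "0 < err"
  by (simp add: err_def)

lemma err_power_20_le: "err ^ 20 \<le> exp (-1)"
proof -
  have "err ^ 20 = (err\<^sup>2) ^ 10" by (simp add: power_mult[symmetric])
  also have "err\<^sup>2 = 8/9" by (simp add: err_def power_divide power_mult_distrib)
  also have "(8/9) ^ 10 \<le> (1/3 :: real)" by (simp add: power_divide)
  also have "\<dots> \<le> exp (-1)" using exp_le by (simp add: exp_minus field_simps)
  finally show ?thesis .
qed

lemma err_le_exp: "err \<le> exp (- 1 / 20)"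
proof -
  have "err ^ 20 \<le> exp (- 1 / 20) ^ 20" using err_power_20_le by (simp flip: exp_of_nat_mult)
  then show ?thesis using power_mono_iff[of err "exp (-1/20)" 20] err_pos by simp
qed

text \<open>The weight is a product over independent positions: one holding \<open>q\<close>
  contributes a factor of mean \<open>err\<close>, every other one the factor 1.\<close>

lemma expectation_correctness_weight:
  "(\<integral>\<^sup>+cs. ennreal (sqrt 2 ^ count_list (zip qs cs) (q, False) / sqrt 2 ^ count_list (zip qs cs) (q, True))
      \<partial>replicate_pmf (length qs) (bernoulli_pmf (2/3))) = ennreal (err ^ count_list qs q)"
proof (induction qs)
  case (Cons a qs)
  define w where "w cs = sqrt 2 ^ count_list (zip qs cs) (q, False) / sqrt 2 ^ count_list (zip qs cs) (q, True)" for cs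
  define W where "W c = (if a = q then if c then 1 / sqrt 2 else sqrt 2 else 1)" for c :: bool
  have w0: "w cs \<ge> 0" for cs by (simp add: w_def)
  have W0: "W c \<ge> 0" for c by (simp add: W_def)
  have "(\<integral>\<^sup>+cs. ennreal (sqrt 2 ^ count_list (zip (a # qs) cs) (q, False) / sqrt 2 ^ count_list (zip (a # qs) cs) (q, True))
      \<partial>replicate_pmf (length (a # qs)) (bernoulli_pmf (2/3)))
     = (\<integral>\<^sup>+c. \<integral>\<^sup>+cs. ennreal (W c) * ennreal (w cs) \<partial>replicate_pmf (length qs) (bernoulli_pmf (2/3)) \<partial>bernoulli_pmf (2/3))"
    unfolding list.size replicate_pmf.simps nn_integral_bind_pmf nn_integral_return_pmf add_Suc_right add_0_right
    by (intro nn_integral_cong) (auto simp: W_def w_def ennreal_mult''[symmetric])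
  also have "\<dots> = (\<integral>\<^sup>+c. ennreal (W c) \<partial>bernoulli_pmf (2/3)) * ennreal (err ^ count_list qs q)"
    using Cons by (simp add: nn_integral_cmult nn_integral_multc w_def distrib_right mult_ac)
  also have "(\<integral>\<^sup>+c. ennreal (W c) \<partial>bernoulli_pmf (2/3)) = ennreal (W True * (2/3) + W False * (1/3))"
    using W0 by (simp add: ennreal_mult''[symmetric] ennreal_plus[symmetric] del: ennreal_plus)
  also have "W True * (2/3) + W False * (1/3) = (if a = q then err else 1)"
    by (simp add: W_def err_def field_simps)
  finally show ?case using err_pos by (simp add: ennreal_mult''[symmetric])
qed simp

text \<open>Whatever the adversary does, only corrupted positions can carry wrong votes, so a wrong
  majority needs at least as many corrupted as uncorrupted copies of \<open>q\<close>.\<close>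

lemma majority_wrong_imp_count_le:
  assumes "majority (answer_batch v adv h qs cs) q \<noteq> correct_answer v q" and "length cs = length qs"
  shows "count_list (zip qs cs) (q, True) \<le> count_list (zip qs cs) (q, False)"
proof -
  let ?B = "answer_batch v adv h qs cs" and ?a = "correct_answer v q"
  have len: "length ?B = length qs" by (simp add: answer_batch_def)
  have nth: "?B ! i = (qs ! i, if cs ! i then correct_answer v (qs ! i) else adv h qs cs i)"
    if "i < length qs" for i using that by (simp add: answer_batch_def)
  have "count_list (zip qs cs) (q, True) \<le> count_list ?B (q, ?a)"
    unfolding count_list_eq_length_filter length_filter_conv_card
    using assms(2) len nth by (intro card_mono) auto
  moreover have "count_list ?B (q, \<not> ?a) \<le> count_list (zip qs cs) (q, False)"
    unfolding count_list_eq_length_filter length_filter_conv_card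
    using assms(2) len nth by (intro card_mono) (auto split: if_splits)
  moreover have "count_list ?B (q, ?a) \<le> count_list ?B (q, \<not> ?a)"
    using assms(1) by (cases ?a) (auto simp: majority_def)
  ultimately show ?thesis by linarith
qed

(* Chernoff bound: the weight is at least 1 whenever the majority of the answers may be wrong. *)
lemma prob_majority_wrong:
  "measure_pmf.prob (replicate_pmf (length qs) (bernoulli_pmf (2/3)))
     {cs. majority (answer_batch v adv h qs cs) q \<noteq> correct_answer v q} \<le> err ^ count_list qs q"
proof -
  let ?M = "replicate_pmf (length qs) (bernoulli_pmf (2/3))"
  let ?E = "{cs. majority (answer_batch v adv h qs cs) q \<noteq> correct_answer v q}"
  have "emeasure ?M ?E = (\<integral>\<^sup>+cs. indicator ?E cs \<partial>?M)" by simp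
  also have "\<dots> \<le> (\<integral>\<^sup>+cs. ennreal (sqrt 2 ^ count_list (zip qs cs) (q, False) / sqrt 2 ^ count_list (zip qs cs) (q, True)) \<partial>?M)"
  proof (rule nn_integral_mono_AE, rule AE_pmfI)
    fix cs assume "cs \<in> set_pmf ?M"
    then have "length cs = length qs" by (simp add: set_replicate_pmf)
    then show "indicator ?E cs \<le> ennreal (sqrt 2 ^ count_list (zip qs cs) (q, False) / sqrt 2 ^ count_list (zip qs cs) (q, True))"
      using majority_wrong_imp_count_le[of v adv h qs cs q]
      by (auto simp: indicator_def power_increasing)
  qed
  also have "\<dots> = ennreal (err ^ count_list qs q)" by (rule expectation_correctness_weight)
  finally show ?thesis using err_pos by (simp add: measure_pmf.emeasure_eq_measure)
qed

lemma count_list_concat_replicate: "count_list (concat (replicate c xs)) x = c * count_list xs x"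
  by (induction c) auto

text \<open>Samples are drawn with replacement, so \<open>Q\<close> may list \<open>q\<close>
  several times; further copies only lower the bound because \<open>err <= 1\<close>.\<close>

lemma prob_majority_wrong_repeated:
  assumes "q \<in> set Q"
  shows "measure_pmf.prob (replicate_pmf (length (concat (replicate c Q))) (bernoulli_pmf (2/3)))
     {cs. majority (answer_batch v adv h (concat (replicate c Q)) cs) q \<noteq> correct_answer v q} \<le> err ^ c"
proof -
  have "err \<le> 1" using err_le_exp by (simp add: order.trans)
  moreover have "count_list Q q \<noteq> 0" using assms by (simp add: count_list_0_iff)
  ultimately have "err ^ count_list (concat (replicate c Q)) q \<le> err ^ c"
    using err_pos by (intro power_decreasing) (auto simp: count_list_concat_replicate)
  then show ?thesis using prob_majority_wrong order.trans by blast
qed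

section \<open>Algorithms composed of pivot and filter rounds\<close>

text \<open>The first parameter is a sample size or a cap, the second a number of repetitions. A
  filter that meets more elements than its cap asks nothing, so the query bound holds on every run
  and not only on the successful ones.\<close>

datatype step = Pivot nat nat | Filter real nat

definition enumeration :: "'a set \<Rightarrow> 'a list" where
  "enumeration S = (SOME xs. set xs = S \<and> distinct xs)"

lemma enumeration:
  assumes "finite S"
  shows "set (enumeration S) = S" and "distinct (enumeration S)" and "length (enumeration S) = card S"
proof -
  have "set (enumeration S) = S \<and> distinct (enumeration S)"
    unfolding enumeration_def by (rule someI_ex) (rule finite_distinct_list[OF assms])
  then show "set (enumeration S) = S" "distinct (enumeration S)" "length (enumeration S) = card S"
    by (auto simp flip: distinct_card)
qed

text \<open>A set of at most \<open>s\<close> elements is taken completely, which turns the last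
  pivot round into an exact search.\<close>

definition sample :: "nat \<Rightarrow> 'a set \<Rightarrow> 'a list pmf" where
  "sample s S = (if card S \<le> s then return_pmf (enumeration S) else replicate_pmf s (pmf_of_set S))"

lemma sample_subset_length:
  assumes "xs \<in> set_pmf (sample s S)" and "finite S" and "S \<noteq> {}"
  shows "set xs \<subseteq> S" and "length xs \<le> s"
  using assms by (auto simp: sample_def enumeration set_replicate_pmf split: if_splits)

fun step_batch :: "step \<Rightarrow> 'a set \<times> 'a \<Rightarrow> 'a query list pmf" where
  "step_batch (Pivot s c) (S, p) = map_pmf (\<lambda>xs. concat (replicate c (List.product xs xs))) (sample s S)"
| "step_batch (Filter m c) (S, p) =
     return_pmf (if real (card S) \<le> m then concat (replicate c (map (Pair p) (enumeration S))) else [])"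

text \<open>The transcript does not record the sample, so its elements are recovered as first
  components of the queries.\<close>

definition winner :: "('a query \<times> bool) list \<Rightarrow> 'a \<Rightarrow> bool" where
  "winner B x \<longleftrightarrow> x \<in> fst ` fst ` set B \<and> (\<forall>y \<in> fst ` fst ` set B. majority B (x, y))"

(* A filter discards the ties with the pivot as well, hence it must keep the pivot itself. *)
fun step_update :: "step \<Rightarrow> 'a set \<times> 'a \<Rightarrow> ('a query \<times> bool) list \<Rightarrow> 'a set \<times> 'a" where
  "step_update (Pivot s c) (S, p) B = (S, if \<exists>x. winner B x then SOME x. winner B x else p)"
| "step_update (Filter m c) (S, p) B =
     (if real (card S) \<le> m then {x \<in> S. x = p \<or> \<not> majority B (p, x)} else S, p)"

fun step_cost :: "step \<Rightarrow> real" where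
  "step_cost (Pivot s c) = real s ^ 2 * real c"
| "step_cost (Filter m c) = max 0 m * real c"

text \<open>The algorithm has no memory besides the transcript, hence its state is recomputed from
  it. In the reversed transcript the newest batch is the head, and \<open>length h\<close> is the
  index of its round.\<close>

primrec rev_state :: "(nat \<Rightarrow> step) \<Rightarrow> 'a set \<times> 'a \<Rightarrow> 'a transcript \<Rightarrow> 'a set \<times> 'a" where
  "rev_state steps \<sigma> [] = \<sigma>"
| "rev_state steps \<sigma> (B # h) = step_update (steps (length h)) (rev_state steps \<sigma> h) B"

definition state :: "(nat \<Rightarrow> step) \<Rightarrow> 'a set \<times> 'a \<Rightarrow> 'a transcript \<Rightarrow> 'a set \<times> 'a" where
  "state steps \<sigma> h = rev_state steps \<sigma> (rev h)"

lemma state_Nil [simp]: "state steps \<sigma> [] = \<sigma>"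
  and state_snoc [simp]: "state steps \<sigma> (h @ [B]) = step_update (steps (length h)) (state steps \<sigma> h) B"
  by (simp_all add: state_def)

definition staged_algorithm :: "nat \<Rightarrow> (nat \<Rightarrow> step) \<Rightarrow> 'a set \<times> 'a \<Rightarrow> 'a algorithm" where
  "staged_algorithm r steps \<sigma> =
     \<lparr>rounds = r,
      next_batch = (\<lambda>h. step_batch (steps (length h)) (state steps \<sigma> h)),
      final_output = (\<lambda>h. return_pmf (snd (state steps \<sigma> h)))\<rparr>"

definition answered :: "('a \<Rightarrow> real) \<Rightarrow> 'a adversary \<Rightarrow> 'a transcript \<Rightarrow> 'a query list \<Rightarrow> ('a query \<times> bool) list pmf" where
  "answered v adv h qs =
     map_pmf (answer_batch v adv h qs) (replicate_pmf (length qs) (bernoulli_pmf (2/3)))"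

lemma run_rounds_Suc:
  "run_rounds A v adv (Suc k) =
     bind_pmf (run_rounds A v adv k) (\<lambda>h. map_pmf (\<lambda>B. h @ [B]) (bind_pmf (next_batch A h) (answered v adv h)))"
  by (simp add: answered_def map_pmf_def bind_assoc_pmf bind_return_pmf)

lemma answered_queries:
  assumes "B \<in> set_pmf (answered v adv h qs)"
  shows "fst ` set B = set qs" and "length B = length qs"
proof -
  have "map fst B = qs"
    using assms by (auto simp: answered_def answer_batch_def o_def map_nth)
  then show "fst ` set B = set qs" "length B = length qs"
    by (metis list.set_map, metis length_map)
qed

lemma length_run_rounds: "h \<in> set_pmf (run_rounds A v adv k) \<Longrightarrow> length h = k"
  by (induction k arbitrary: h) (auto simp: run_rounds_Suc simp del: run_rounds.simps(2))

definition valid :: "'a set \<Rightarrow> 'a set \<times> 'a \<Rightarrow> bool" where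
  "valid X \<sigma> \<longleftrightarrow> fst \<sigma> \<subseteq> X \<and> snd \<sigma> \<in> fst \<sigma>"

lemma step_batch_bounds:
  assumes "qs \<in> set_pmf (step_batch st \<sigma>)" and "valid X \<sigma>" and "finite X"
  shows "set qs \<subseteq> fst \<sigma> \<times> fst \<sigma>" and "real (length qs) \<le> step_cost st"
proof -
  obtain S p where \<sigma>: "\<sigma> = (S, p)" by (cases \<sigma>)
  have S: "S \<subseteq> X" "p \<in> S" "finite S" using assms \<sigma> finite_subset by (auto simp: valid_def)
  have "set qs \<subseteq> S \<times> S \<and> real (length qs) \<le> step_cost st"
  proof (cases st)
    case (Pivot s c)
    then obtain xs where xs: "xs \<in> set_pmf (sample s S)" "qs = concat (replicate c (List.product xs xs))"
      using assms(1) \<sigma> by auto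
    have le: "set xs \<subseteq> S" "length xs \<le> s" using sample_subset_length[OF xs(1)] S by auto
    have "length qs = c * (length xs)\<^sup>2"
      by (simp add: xs(2) length_concat sum_list_replicate power2_eq_square)
    moreover have "(length xs)\<^sup>2 \<le> s\<^sup>2" using le(2) by (rule power_mono) simp
    ultimately have "length qs \<le> s\<^sup>2 * c" by (simp add: mult.commute)
    then have "real (length qs) \<le> real s ^ 2 * real c"
      by (metis of_nat_le_iff of_nat_mult of_nat_power)
    then show ?thesis using le(1) Pivot by (auto simp: xs(2))
  next
    case (Filter m c)
    have "length (concat (replicate c (map (Pair p) (enumeration S)))) = c * card S"
      using enumeration(3)[OF S(3)] by (simp add: length_concat sum_list_replicate)
    moreover have "real c * real (card S) \<le> real c * m" if "real (card S) \<le> m"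
      using that by (intro mult_left_mono) auto
    ultimately show ?thesis
      using Filter assms(1) \<sigma> S enumeration(1)[OF S(3)]
      by (auto simp: mult.commute max_def split: if_splits)
  qed
  then show "set qs \<subseteq> fst \<sigma> \<times> fst \<sigma>" "real (length qs) \<le> step_cost st"
    by (auto simp: \<sigma>)
qed

lemma valid_step_update:
  assumes "valid X \<sigma>" and "fst ` set B \<subseteq> fst \<sigma> \<times> fst \<sigma>"
  shows "valid X (step_update st \<sigma> B)"
proof -
  obtain S p where \<sigma>: "\<sigma> = (S, p)" by (cases \<sigma>)
  have "(SOME x. winner B x) \<in> S" if "\<exists>x. winner B x"
    using someI_ex[OF that] assms(2) \<sigma> by (auto simp: winner_def)
  then show ?thesis using assms \<sigma> by (cases st) (auto simp: valid_def)
qed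

lemma staged_algorithm_support:
  assumes "h \<in> set_pmf (run_rounds (staged_algorithm r steps \<sigma>) v adv k)" and "valid X \<sigma>" and "finite X"
  shows "valid X (state steps \<sigma> h) \<and> (\<forall>B\<in>set h. fst ` set B \<subseteq> X \<times> X) \<and>
         real (sum_list (map length h)) \<le> (\<Sum>i<k. step_cost (steps i))"
  using assms(1)
proof (induction k arbitrary: h)
  case 0
  then show ?case using assms by simp
next
  case (Suc k)
  from Suc.prems obtain h' qs B where h': "h' \<in> set_pmf (run_rounds (staged_algorithm r steps \<sigma>) v adv k)"
    and qs: "qs \<in> set_pmf (step_batch (steps (length h')) (state steps \<sigma> h'))"
    and B: "B \<in> set_pmf (answered v adv h' qs)" and h: "h = h' @ [B]"
    by (auto simp: run_rounds_Suc staged_algorithm_def simp del: run_rounds.simps(2))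
  note IH = Suc.IH[OF h']
  have len: "length h' = k" using length_run_rounds[OF h'] .
  note bounds = step_batch_bounds[OF qs conjunct1[OF IH] assms(3)]
  have "fst ` set B \<subseteq> fst (state steps \<sigma> h') \<times> fst (state steps \<sigma> h')"
    using answered_queries[OF B] bounds by simp
  moreover have "valid X (state steps \<sigma> h)"
    using valid_step_update[OF _ calculation] IH by (simp add: h)
  moreover have "fst (state steps \<sigma> h') \<subseteq> X" using IH by (simp add: valid_def)
  ultimately show ?case
    using IH bounds(2) answered_queries(2)[OF B] len by (auto simp: h)
qed

lemma staged_algorithm_queries:
  assumes "valid X \<sigma>" and "finite X"
  shows "rounds (staged_algorithm r steps \<sigma>) = r"
    and "queries_only (staged_algorithm r steps \<sigma>) X"
    and "(\<Sum>i<r. step_cost (steps i)) \<le> q \<Longrightarrow> query_complexity_le (staged_algorithm r steps \<sigma>) q"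
proof -
  show r: "rounds (staged_algorithm r steps \<sigma>) = r" by (simp add: staged_algorithm_def)
  show "queries_only (staged_algorithm r steps \<sigma>) X"
    using staged_algorithm_support[OF _ assms]
    unfolding queries_only_def final_transcript_def r by blast
  show "query_complexity_le (staged_algorithm r steps \<sigma>) q" if "(\<Sum>i<r. step_cost (steps i)) \<le> q"
    using staged_algorithm_support[OF _ assms] that
    unfolding query_complexity_le_def final_transcript_def r by (meson order.trans)
qed

section \<open>The invariant and its failure probability along a run\<close>

text \<open>Only remaining elements above the pivot are counted. As a maximum of \<open>X\<close> is
  still present, the bound \<open>a = 0\<close> makes the pivot itself a maximum.\<close>

definition good :: "('a \<Rightarrow> real) \<Rightarrow> 'a set \<Rightarrow> real \<Rightarrow> real \<Rightarrow> 'a set \<times> 'a \<Rightarrow> bool" where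
  "good v X a m \<sigma> \<longleftrightarrow> valid X \<sigma> \<and> (\<exists>x \<in> fst \<sigma>. \<forall>y \<in> X. v y \<le> v x) \<and>
     real (card {x \<in> fst \<sigma>. v (snd \<sigma>) < v x}) \<le> a \<and> real (card (fst \<sigma>)) \<le> m"

definition fails :: "('a \<Rightarrow> real) \<Rightarrow> 'a adversary \<Rightarrow> (nat \<Rightarrow> step) \<Rightarrow> 'a set \<times> 'a \<Rightarrow> nat \<Rightarrow>
    ('a set \<times> 'a \<Rightarrow> bool) \<Rightarrow> real" where
  "fails v adv steps \<sigma> k I =
     measure_pmf.prob (run_rounds (staged_algorithm 0 steps \<sigma>) v adv k) {h. \<not> I (state steps \<sigma> h)}"

lemma run_rounds_staged_algorithm:
  "run_rounds (staged_algorithm r steps \<sigma>) v adv k = run_rounds (staged_algorithm r' steps \<sigma>) v adv k"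
  by (induction k) (simp_all add: staged_algorithm_def)

lemma fails_0: "I \<sigma> \<Longrightarrow> fails v adv steps \<sigma> 0 I = 0"
  by (simp add: fails_def)

text \<open>A union bound over rounds. The bound \<open>d\<close> is required for each fixed
  transcript, which covers adversaries that react to the history.\<close>

lemma fails_Suc:
  assumes "fails v adv steps \<sigma> k I \<le> e" and "0 \<le> d"
    and "\<And>h. I (state steps \<sigma> h) \<Longrightarrow>
      measure_pmf.prob (bind_pmf (step_batch (steps k) (state steps \<sigma> h)) (answered v adv h))
        {B. \<not> J (step_update (steps k) (state steps \<sigma> h) B)} \<le> d"
  shows "fails v adv steps \<sigma> (Suc k) J \<le> e + d"
  unfolding fails_def run_rounds_Suc
proof (rule prob_bind_pmf_le[OF assms(1)[unfolded fails_def] assms(2)])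
  fix h assume h: "h \<in> set_pmf (run_rounds (staged_algorithm 0 steps \<sigma>) v adv k)"
    "h \<notin> {h. \<not> I (state steps \<sigma> h)}"
  then have "length h = k" using length_run_rounds by blast
  then show "measure_pmf.prob (map_pmf (\<lambda>B. h @ [B])
      (bind_pmf (next_batch (staged_algorithm 0 steps \<sigma>) h) (answered v adv h)))
     {h. \<not> J (state steps \<sigma> h)} \<le> d"
    using assms(3)[of h] h by (simp add: staged_algorithm_def vimage_def)
qed

lemma returns_max_if_fails_le:
  assumes "\<And>v adv. fails v adv steps \<sigma> r (good v X 0 (m v)) \<le> \<delta>" and "finite X"
  shows "returns_max_with_prob_ge (staged_algorithm r steps \<sigma>) X (1 - \<delta>)"
  unfolding returns_max_with_prob_ge_def
proof (intro allI)
  fix v :: "'a \<Rightarrow> real" and adv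
  let ?A = "staged_algorithm r steps \<sigma>"
  have "x = snd (state steps \<sigma> h) \<Longrightarrow> is_arg_max v (\<lambda>y. y \<in> X) x"
    if good: "good v X 0 (m v) (state steps \<sigma> h)" for h x
  proof -
    obtain S p where \<sigma>': "state steps \<sigma> h = (S, p)" by (cases "state steps \<sigma> h")
    have S: "S \<subseteq> X" "p \<in> S" "finite S"
      using good \<sigma>' assms(2) finite_subset by (auto simp: good_def valid_def)
    have "card {x \<in> S. v p < v x} = 0" using good \<sigma>' by (simp add: good_def)
    then have "{x \<in> S. v p < v x} = {}" using S(3) by simp
    moreover obtain z where "z \<in> S" "\<forall>y\<in>X. v y \<le> v z" using good \<sigma>' by (auto simp: good_def)
    ultimately have "\<forall>y\<in>X. v y \<le> v p" by force
    then show "x = snd (state steps \<sigma> h) \<Longrightarrow> is_arg_max v (\<lambda>y. y \<in> X) x"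
      using S \<sigma>' by (auto simp: is_arg_max_def not_less)
  qed
  then have sub: "{h. good v X 0 (m v) (state steps \<sigma> h)} \<subseteq>
      {h. is_arg_max v (\<lambda>y. y \<in> X) (snd (state steps \<sigma> h))}" by blast
  have res: "result ?A v adv = map_pmf (\<lambda>h. snd (state steps \<sigma> h)) (run_rounds ?A v adv r)"
    by (simp add: result_def final_transcript_def staged_algorithm_def map_pmf_def)
  have "1 - \<delta> \<le> 1 - measure_pmf.prob (run_rounds ?A v adv r) {h. \<not> good v X 0 (m v) (state steps \<sigma> h)}"
    using assms(1)[of v adv] unfolding fails_def run_rounds_staged_algorithm[of 0 _ _ _ _ _ r] by simp
  also have "\<dots> = measure_pmf.prob (run_rounds ?A v adv r) {h. good v X 0 (m v) (state steps \<sigma> h)}"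
    using measure_pmf.prob_compl[of "{h. \<not> good v X 0 (m v) (state steps \<sigma> h)}" "run_rounds ?A v adv r"]
    by (simp add: Compl_eq_Diff_UNIV[symmetric] Collect_neg_eq[symmetric])
  also have "\<dots> \<le> measure_pmf.prob (run_rounds ?A v adv r) {h. is_arg_max v (\<lambda>y. y \<in> X) (snd (state steps \<sigma> h))}"
    by (rule measure_pmf.finite_measure_mono[OF sub]) simp
  also have "\<dots> = measure_pmf.prob (result ?A v adv) {x. is_arg_max v (\<lambda>y. y \<in> X) x}"
    by (simp add: res vimage_def)
  finally show "1 - \<delta> \<le> measure_pmf.prob (result ?A v adv) {x. is_arg_max v (\<lambda>y. y \<in> X) x}" .
qed

section \<open>Failure probability of a round\<close>

lemma finite_obtains_max:
  fixes v :: "'a \<Rightarrow> 'b::linorder"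
  assumes "finite S" and "S \<noteq> {}"
  obtains z where "z \<in> S" and "\<And>y. y \<in> S \<Longrightarrow> v y \<le> v z"
proof -
  have "Max (v ` S) \<in> v ` S" using assms by (intro Max_in) auto
  then obtain z where "z \<in> S" "v z = Max (v ` S)" by force
  then show thesis using that[of z] assms by simp
qed

lemma prob_answered_wrong_le:
  assumes "q \<in> set Q"
  shows "measure_pmf.prob (answered v adv h (concat (replicate c Q)))
     {B. majority B q \<noteq> correct_answer v q} \<le> err ^ c"
  using prob_majority_wrong_repeated[OF assms]
  unfolding answered_def measure_map_pmf vimage_def mem_Collect_eq .

lemma prob_answered_Union_wrong_le:
  assumes "finite K" and "K \<subseteq> set Q" and "real (card K) \<le> N"
  shows "measure_pmf.prob (answered v adv h (concat (replicate c Q)))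
     {B. \<exists>q\<in>K. majority B q \<noteq> correct_answer v q} \<le> N * err ^ c"
proof -
  let ?M = "answered v adv h (concat (replicate c Q))"
  have "{B. \<exists>q\<in>K. majority B q \<noteq> correct_answer v q} = (\<Union>q\<in>K. {B. majority B q \<noteq> correct_answer v q})"
    by auto
  then have "measure_pmf.prob ?M {B. \<exists>q\<in>K. majority B q \<noteq> correct_answer v q}
      \<le> (\<Sum>q\<in>K. measure_pmf.prob ?M {B. majority B q \<noteq> correct_answer v q})"
    by (simp add: assms(1) measure_pmf.finite_measure_subadditive_finite)
  also have "\<dots> \<le> (\<Sum>q\<in>K. err ^ c)"
    using assms(2) by (intro sum_mono prob_answered_wrong_le) auto
  also have "\<dots> \<le> N * err ^ c"
    using assms(3) err_pos by (simp add: mult_right_mono)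
  finally show ?thesis .
qed

section \<open>Pivot rounds\<close>

definition rank_le :: "('a \<Rightarrow> real) \<Rightarrow> 'a set \<Rightarrow> real \<Rightarrow> 'a set" where
  "rank_le v S a = {x \<in> S. real (card {y \<in> S. v x < v y}) \<le> a}"

text \<open>A highest element outside \<open>rank_le v S a\<close> has more than \<open>a\<close>
  elements above it, and all of these lie inside.\<close>

lemma card_rank_le:
  assumes "finite S" and "rank_le v S a \<noteq> S"
  shows "a \<le> card (rank_le v S a)"
proof -
  let ?N = "S - rank_le v S a"
  have N: "finite ?N" "?N \<noteq> {}" using assms by (auto simp: rank_le_def)
  obtain z where z: "z \<in> ?N" "\<And>y. y \<in> ?N \<Longrightarrow> v y \<le> v z"
    using finite_obtains_max[OF N, of v] by blast
  have "{y \<in> S. v z < v y} \<subseteq> rank_le v S a" using z(2) by force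
  then have "card {y \<in> S. v z < v y} \<le> card (rank_le v S a)"
    using assms(1) by (intro card_mono) (auto simp: rank_le_def)
  moreover have "a < card {y \<in> S. v z < v y}" using z(1) by (auto simp: rank_le_def)
  ultimately show ?thesis by linarith
qed

text \<open>Each independent draw misses with probability at most
  \<open>1 - a / m <= exp (- (a / m))\<close>. A complete sample contains a maximum and cannot
  miss.\<close>

lemma prob_sample_misses_rank_le:
  assumes "finite S" and "S \<noteq> {}" and "0 < s" and "0 \<le> a" and "real (card S) \<le> m"
  shows "measure_pmf.prob (sample s S) {xs. set xs \<inter> rank_le v S a = {}} \<le> exp (- a * s / m)"
proof (cases "card S \<le> s")
  case True
  obtain z where z: "z \<in> S" "\<And>y. y \<in> S \<Longrightarrow> v y \<le> v z"
    using finite_obtains_max[OF assms(1,2), of v] by blast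
  then have "{y \<in> S. v z < v y} = {}" by force
  then have "z \<in> rank_le v S a" using z(1) assms(4) by (simp add: rank_le_def del: Collect_empty_eq)
  then show ?thesis using True z(1) enumeration(1)[OF assms(1)] by (auto simp: sample_def indicator_def)
next
  case False
  let ?T = "rank_le v S a"
  have cS: "0 < real (card S)" using assms by (simp add: card_gt_0_iff)
  have T: "?T \<subseteq> S" by (auto simp: rank_le_def)
  have "measure_pmf.prob (sample s S) {xs. set xs \<inter> ?T = {}} = measure_pmf.prob (pmf_of_set S) (- ?T) ^ s"
    using False prob_replicate_pmf_subset[of s "pmf_of_set S" "- ?T"]
    by (simp add: sample_def disjoint_eq_subset_Compl)
  also have "measure_pmf.prob (pmf_of_set S) (- ?T) = 1 - card ?T / card S"
  proof -
    have "card (S \<inter> - ?T) = card S - card ?T"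
      using T assms(1) by (metis Diff_eq card_Diff_subset finite_subset)
    moreover have "card ?T \<le> card S" using T assms(1) by (rule card_mono[rotated])
    ultimately show ?thesis using assms cS by (simp add: measure_pmf_of_set of_nat_diff diff_divide_distrib)
  qed
  also have "(1 - card ?T / card S) ^ s \<le> exp (- a * s / m)"
  proof (cases "?T = S")
    case True
    then show ?thesis using cS assms(3) by (simp add: zero_power)
  next
    case False
    have "card ?T \<le> card S" using T assms(1) by (rule card_mono[rotated])
    then have nonneg: "0 \<le> 1 - card ?T / card S" using cS by simp
    have "a / m \<le> card ?T / card S"
      using card_rank_le[OF assms(1) False] assms(4,5) cS by (intro frac_le) auto
    then have "1 - card ?T / card S \<le> exp (- (a / m))"
      using exp_ge_add_one_self[of "- (a / m)"] by linarith
    then have "(1 - card ?T / card S) ^ s \<le> exp (- (a / m)) ^ s"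
      using nonneg by (intro power_mono) auto
    also have "\<dots> = exp (- a * s / m)" by (simp add: exp_of_nat_mult[symmetric] mult.commute)
    finally show ?thesis .
  qed
  finally show ?thesis .
qed

text \<open>If every vote on the sample is right, the winners are exactly its maximal elements, so
  whichever one is chosen is at least as high as the sampled element of small rank.\<close>

lemma good_step_Pivot_if_correct:
  assumes "good v X a m (S, p)" and "finite X" and "c > 0"
    and xs: "set xs \<subseteq> S" "set xs \<inter> rank_le v S a' \<noteq> {}"
    and B: "B \<in> set_pmf (answered v adv h (concat (replicate c (List.product xs xs))))"
    and correct: "\<And>q. q \<in> set xs \<times> set xs \<Longrightarrow> majority B q = correct_answer v q"
  shows "good v X a' m (step_update (Pivot s c) (S, p) B)"
proof -
  have S: "S \<subseteq> X" "finite S" using assms(1,2) finite_subset by (auto simp: good_def valid_def)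
  have "fst ` set B = set xs \<times> set xs"
    using answered_queries(1)[OF B] \<open>c > 0\<close> by (simp add: set_replicate_conv_if)
  then have Y: "fst ` fst ` set B = set xs" by auto
  have winner: "winner B x \<longleftrightarrow> x \<in> set xs \<and> (\<forall>y\<in>set xs. v y \<le> v x)" for x
    using correct by (auto simp: winner_def Y correct_answer_def)
  have "\<exists>x. winner B x"
    unfolding winner using xs(2) finite_obtains_max[of "set xs" v] by (metis List.finite_set inf_bot_left)
  then obtain q where q: "winner B q" "step_update (Pivot s c) (S, p) B = (S, q)"
    using someI_ex[of "winner B"] by auto
  obtain t where t: "t \<in> set xs" "t \<in> rank_le v S a'" using xs(2) by auto
  have "v t \<le> v q" using q(1) t(1) by (simp add: winner)
  then have "card {x \<in> S. v q < v x} \<le> card {x \<in> S. v t < v x}"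
    using S(2) by (intro card_mono) auto
  then have "real (card {x \<in> S. v q < v x}) \<le> a'" using t(2) by (simp add: rank_le_def)
  then show ?thesis
    using assms(1) q winner xs(1) by (auto simp: good_def valid_def)
qed

lemma prob_Pivot:
  assumes "good v X a m \<sigma>" and "finite X" and "s > 0" and "c > 0" and "0 \<le> a'"
  shows "measure_pmf.prob (bind_pmf (step_batch (Pivot s c) \<sigma>) (answered v adv h))
     {B. \<not> good v X a' m (step_update (Pivot s c) \<sigma> B)} \<le> exp (- a' * s / m) + real s ^ 2 * err ^ c"
proof -
  obtain S p where \<sigma>: "\<sigma> = (S, p)" by (cases \<sigma>)
  have S: "S \<noteq> {}" "finite S" "real (card S) \<le> m"
    using assms(1,2) \<sigma> finite_subset by (auto simp: good_def valid_def)
  let ?Q = "\<lambda>xs. concat (replicate c (List.product xs xs))"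
  have "measure_pmf.prob (bind_pmf (sample s S) (\<lambda>xs. answered v adv h (?Q xs)))
     {B. \<not> good v X a' m (step_update (Pivot s c) \<sigma> B)} \<le> exp (- a' * s / m) + real s ^ 2 * err ^ c"
  proof (rule prob_bind_pmf_le[where B = "{xs. set xs \<inter> rank_le v S a' = {}}"])
    show "measure_pmf.prob (sample s S) {xs. set xs \<inter> rank_le v S a' = {}} \<le> exp (- a' * s / m)"
      using prob_sample_misses_rank_le S assms by blast
    show "0 \<le> real s ^ 2 * err ^ c" using err_pos by simp
    fix xs assume xs: "xs \<in> set_pmf (sample s S)" "xs \<notin> {xs. set xs \<inter> rank_le v S a' = {}}"
    note xs' = sample_subset_length[OF xs(1) S(2,1)]
    have "measure_pmf.prob (answered v adv h (?Q xs)) {B. \<not> good v X a' m (step_update (Pivot s c) \<sigma> B)}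
        \<le> measure_pmf.prob (answered v adv h (?Q xs)) {B. \<exists>q\<in>set xs \<times> set xs. majority B q \<noteq> correct_answer v q}"
      using good_step_Pivot_if_correct[OF assms(1)[unfolded \<sigma>] assms(2,4) xs'(1)] xs(2)
      unfolding \<sigma> mem_Collect_eq
      by (intro measure_pmf.finite_measure_mono_AE AE_pmfI impI CollectI) (blast | simp)+
    also have "\<dots> \<le> real s ^ 2 * err ^ c"
    proof (rule prob_answered_Union_wrong_le)
      have "card (set xs) \<le> s" using card_length[of xs] xs'(2) by linarith
      then have "card (set xs) * card (set xs) \<le> s * s" by (rule mult_le_mono) fact
      then show "real (card (set xs \<times> set xs)) \<le> real s ^ 2"
        by (simp add: power2_eq_square card_cartesian_product flip: of_nat_mult)
    qed auto
    finally show "measure_pmf.prob (answered v adv h (?Q xs))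
      {B. \<not> good v X a' m (step_update (Pivot s c) \<sigma> B)} \<le> real s ^ 2 * err ^ c" .
  qed
  then show ?thesis by (simp add: \<sigma> bind_map_pmf)
qed

lemma prob_Pivot_exhaustive:
  assumes "good v X a m \<sigma>" and "finite X" and "m \<le> s" and "c > 0"
  shows "measure_pmf.prob (bind_pmf (step_batch (Pivot s c) \<sigma>) (answered v adv h))
     {B. \<not> good v X 0 m (step_update (Pivot s c) \<sigma> B)} \<le> real s ^ 2 * err ^ c"
proof -
  obtain S p where \<sigma>: "\<sigma> = (S, p)" by (cases \<sigma>)
  have S: "S \<noteq> {}" "finite S" "card S \<le> s"
    using assms(1,2,3) \<sigma> finite_subset by (auto simp: good_def valid_def)
  let ?xs = "enumeration S"
  let ?Q = "concat (replicate c (List.product ?xs ?xs))"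
  note xs = enumeration[OF S(2)]
  obtain z where z: "z \<in> S" "\<And>y. y \<in> S \<Longrightarrow> v y \<le> v z"
    using finite_obtains_max[OF S(2,1), of v] by blast
  then have "{y \<in> S. v z < v y} = {}" by force
  then have "z \<in> rank_le v S 0" using z(1) by (simp add: rank_le_def del: Collect_empty_eq)
  then have hit: "set ?xs \<inter> rank_le v S 0 \<noteq> {}" using z(1) xs(1) by auto
  have "measure_pmf.prob (answered v adv h ?Q) {B. \<not> good v X 0 m (step_update (Pivot s c) \<sigma> B)}
      \<le> measure_pmf.prob (answered v adv h ?Q) {B. \<exists>q\<in>S \<times> S. majority B q \<noteq> correct_answer v q}"
    using good_step_Pivot_if_correct[OF assms(1)[unfolded \<sigma>] assms(2,4) _ hit] xs(1)
    unfolding \<sigma> mem_Collect_eq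
    by (intro measure_pmf.finite_measure_mono_AE AE_pmfI impI CollectI) (blast | simp)+
  also have "\<dots> \<le> real s ^ 2 * err ^ c"
  proof (rule prob_answered_Union_wrong_le)
    have "card S * card S \<le> s * s" by (rule mult_le_mono) fact+
    then show "real (card (S \<times> S)) \<le> real s ^ 2"
      by (simp add: power2_eq_square card_cartesian_product flip: of_nat_mult)
  qed (use xs S in auto)
  finally show ?thesis using S(3) by (simp add: \<sigma> sample_def bind_return_pmf)
qed

section \<open>Filter rounds\<close>

text \<open>The survivors are the elements above the pivot (at most \<open>a\<close>), the pivot
  itself (the summand 1) and misjudged elements (at most \<open>f\<close>, by Markov's inequality).
  Keeping a maximum needs only one right vote, for a fixed maximum \<open>z\<close>, hence the
  summand \<open>err ^ c\<close> without a factor \<open>card X\<close>.\<close>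

lemma prob_Filter:
  assumes "good v X a m \<sigma>" and "finite X" and "f > 0"
  shows "measure_pmf.prob (bind_pmf (step_batch (Filter m c) \<sigma>) (answered v adv h))
     {B. \<not> good v X a (a + 1 + f) (step_update (Filter m c) \<sigma> B)} \<le> (1 + card X / f) * err ^ c"
proof -
  obtain S p where \<sigma>: "\<sigma> = (S, p)" by (cases \<sigma>)
  have S: "S \<subseteq> X" "p \<in> S" "finite S" "real (card S) \<le> m"
    and above: "real (card {x \<in> S. v p < v x}) \<le> a"
    using assms(1,2) \<sigma> finite_subset by (auto simp: good_def valid_def)
  obtain z where z: "z \<in> S" "\<forall>y\<in>X. v y \<le> v z" using assms(1) \<sigma> by (auto simp: good_def)
  let ?Q = "map (Pair p) (enumeration S)"
  let ?M = "answered v adv h (concat (replicate c ?Q))"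
  let ?E1 = "{B. majority B (p, z) \<noteq> correct_answer v (p, z)}"
  let ?E2 = "{B. f < real (card {x \<in> S. majority B (p, x) \<noteq> correct_answer v (p, x)})}"
  have Q: "(p, x) \<in> set ?Q" if "x \<in> S" for x using that enumeration(1)[OF S(3)] by auto
  have bad: "B \<in> ?E1 \<union> ?E2" if "\<not> good v X a (a + 1 + f) (step_update (Filter m c) \<sigma> B)" for B
  proof (rule ccontr)
    assume "B \<notin> ?E1 \<union> ?E2"
    then have ok: "majority B (p, z) = correct_answer v (p, z)"
      and few: "real (card {x \<in> S. majority B (p, x) \<noteq> correct_answer v (p, x)}) \<le> f" by auto
    let ?S' = "{x \<in> S. x = p \<or> \<not> majority B (p, x)}"
    have "\<exists>x\<in>?S'. \<forall>y\<in>X. v y \<le> v x"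
    \<comment> \<open>If the pivot ties with \<open>z\<close>, a right vote discards
      \<open>z\<close>, but then the pivot is itself a maximum and it is always kept.\<close>
    proof (cases "v z \<le> v p")
      case True
      then show ?thesis using z S(2) by (intro bexI[of _ p]) force+
    next
      case False
      then show ?thesis using z ok by (intro bexI[of _ z]) (auto simp: correct_answer_def)
    qed
    moreover have "real (card {x \<in> ?S'. v p < v x}) \<le> a"
    proof -
      have "card {x \<in> ?S'. v p < v x} \<le> card {x \<in> S. v p < v x}"
        using S(3) by (intro card_mono) auto
      then show ?thesis using above by linarith
    qed
    moreover have "real (card ?S') \<le> a + 1 + f"
    proof -
      let ?A = "{x \<in> S. v p < v x}" and ?F = "{x \<in> S. majority B (p, x) \<noteq> correct_answer v (p, x)}"
      have "card ?S' \<le> card ((?A \<union> {p}) \<union> ?F)"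
        using S(3) by (intro card_mono) (auto simp: correct_answer_def)
      also have "\<dots> \<le> card (?A \<union> {p}) + card ?F" by (rule card_Un_le)
      also have "\<dots> \<le> card ?A + card {p} + card ?F" by (rule add_right_mono, rule card_Un_le)
      finally show ?thesis using above few by simp
    qed
    ultimately have "good v X a (a + 1 + f) (step_update (Filter m c) \<sigma> B)"
      using S by (auto simp: \<sigma> good_def valid_def)
    with that show False by simp
  qed
  then have "measure_pmf.prob ?M {B. \<not> good v X a (a + 1 + f) (step_update (Filter m c) \<sigma> B)}
      \<le> measure_pmf.prob ?M (?E1 \<union> ?E2)"
    by (intro measure_pmf.finite_measure_mono) auto
  also have "\<dots> \<le> measure_pmf.prob ?M ?E1 + measure_pmf.prob ?M ?E2"
    by (rule measure_Un_le) auto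
  also have "\<dots> \<le> err ^ c + card S * err ^ c / f"
    using prob_answered_wrong_le[OF Q] prob_answered_wrong_le[OF Q[OF z(1)]] S(3) assms(3)
    by (intro add_mono prob_card_gt_le) auto
  also have "\<dots> \<le> err ^ c + card X * err ^ c / f"
    using card_mono[OF assms(2) S(1)] assms(3) err_pos
    by (intro add_left_mono divide_right_mono mult_right_mono) auto
  also have "\<dots> = (1 + card X / f) * err ^ c" by (simp add: distrib_right)
  finally show ?thesis using S(4) by (simp add: \<sigma> bind_return_pmf)
qed

section \<open>Adding up failures over successive rounds\<close>

lemma good_mono: "good v X a m \<sigma> \<Longrightarrow> a \<le> a' \<Longrightarrow> m \<le> m' \<Longrightarrow> good v X a' m' \<sigma>"
  by (auto simp: good_def)

lemma fails_mono: "(\<And>\<sigma>. I \<sigma> \<Longrightarrow> J \<sigma>) \<Longrightarrow> fails v adv steps \<sigma> k J \<le> fails v adv steps \<sigma> k I"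
  unfolding fails_def by (rule measure_pmf.finite_measure_mono) (blast, simp)

lemma fails_good_mono:
  "fails v adv steps \<sigma> k (good v X a m) \<le> e \<Longrightarrow> a \<le> a' \<Longrightarrow> m \<le> m' \<Longrightarrow>
   fails v adv steps \<sigma> k (good v X a' m') \<le> e"
  by (rule order.trans[OF fails_mono]) (auto intro: good_mono)

text \<open>Every nonempty set exceeds the cap 0, so nothing is asked or changed. Idle rounds pad a
  schedule to exactly the prescribed number of rounds.\<close>

abbreviation idle :: step where "idle \<equiv> Filter 0 0"

lemma step_update_idle:
  assumes "valid X \<sigma>" and "finite X"
  shows "step_update idle \<sigma> B = \<sigma>"
proof -
  obtain S p where \<sigma>: "\<sigma> = (S, p)" by (cases \<sigma>)
  then have "finite S" "S \<noteq> {}" using assms finite_subset[of S X] by (auto simp: valid_def)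
  then have "card S \<noteq> 0" by simp
  then show ?thesis by (simp add: \<sigma>)
qed

lemma fails_idle:
  assumes "fails v adv steps \<sigma> k (good v X a m) \<le> e" and "steps k = idle" and "finite X"
  shows "fails v adv steps \<sigma> (Suc k) (good v X a m) \<le> e"
proof -
  have "fails v adv steps \<sigma> (Suc k) (good v X a m) \<le> e + 0"
  proof (rule fails_Suc[OF assms(1)])
    fix h assume *: "good v X a m (state steps \<sigma> h)"
    then have "valid X (state steps \<sigma> h)" by (simp add: good_def)
    then show "measure_pmf.prob (bind_pmf (step_batch (steps k) (state steps \<sigma> h)) (answered v adv h))
        {B. \<not> good v X a m (step_update (steps k) (state steps \<sigma> h) B)} \<le> 0"
      using * assms(2,3) by (simp add: step_update_idle)
  qed simp
  then show ?thesis by simp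
qed

lemma fails_Pivot:
  assumes "fails v adv steps \<sigma> k (good v X a m) \<le> e" and "steps k = Pivot s c" and "finite X"
    and "s > 0" and "c > 0" and "0 \<le> a'" and "exp (- a' * s / m) + real s ^ 2 * err ^ c \<le> d"
  shows "fails v adv steps \<sigma> (Suc k) (good v X a' m) \<le> e + d"
proof (rule fails_Suc[OF assms(1)])
  have "0 \<le> exp (- a' * s / m) + real s ^ 2 * err ^ c" using err_pos by simp
  then show "0 \<le> d" using assms(7) by linarith
  show "measure_pmf.prob (bind_pmf (step_batch (steps k) (state steps \<sigma> h)) (answered v adv h))
        {B. \<not> good v X a' m (step_update (steps k) (state steps \<sigma> h) B)} \<le> d"
    if "good v X a m (state steps \<sigma> h)" for h
    using order.trans[OF prob_Pivot[OF that assms(3-6)] assms(7)] assms(2) by simp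
qed

lemma fails_Pivot_exhaustive:
  assumes "fails v adv steps \<sigma> k (good v X a m) \<le> e" and "steps k = Pivot s c" and "finite X"
    and "m \<le> s" and "c > 0" and "real s ^ 2 * err ^ c \<le> d"
  shows "fails v adv steps \<sigma> (Suc k) (good v X 0 m) \<le> e + d"
proof (rule fails_Suc[OF assms(1)])
  have "0 \<le> real s ^ 2 * err ^ c" using err_pos by simp
  then show "0 \<le> d" using assms(6) by linarith
  show "measure_pmf.prob (bind_pmf (step_batch (steps k) (state steps \<sigma> h)) (answered v adv h))
        {B. \<not> good v X 0 m (step_update (steps k) (state steps \<sigma> h) B)} \<le> d"
    if "good v X a m (state steps \<sigma> h)" for h
    using order.trans[OF prob_Pivot_exhaustive[OF that assms(3-5)] assms(6)] assms(2) by simp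
qed

lemma fails_Filter:
  assumes "fails v adv steps \<sigma> k (good v X a m) \<le> e" and "steps k = Filter m c" and "finite X"
    and "f > 0" and "(1 + card X / f) * err ^ c \<le> d"
  shows "fails v adv steps \<sigma> (Suc k) (good v X a (a + 1 + f)) \<le> e + d"
proof (rule fails_Suc[OF assms(1)])
  have "0 \<le> (1 + card X / f) * err ^ c" using err_pos assms(4) by simp
  then show "0 \<le> d" using assms(5) by linarith
  show "measure_pmf.prob (bind_pmf (step_batch (steps k) (state steps \<sigma> h)) (answered v adv h))
        {B. \<not> good v X a (a + 1 + f) (step_update (steps k) (state steps \<sigma> h) B)} \<le> d"
    if "good v X a m (state steps \<sigma> h)" for h
    using order.trans[OF prob_Filter[OF that assms(3,4)] assms(5)] assms(2) by simp
qed

lemma good_initial: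
  assumes "finite X" and "p \<in> X"
  shows "good v X (card X) (card X) (X, p)"
proof -
  obtain z where "z \<in> X" "\<And>y. y \<in> X \<Longrightarrow> v y \<le> v z"
    using finite_obtains_max[of X v] assms by blast
  then show ?thesis using assms by (auto simp: good_def valid_def intro: card_mono)
qed

section \<open>Repetition counts and towers\<close>

text \<open>As \<open>err <= exp (- 1 / 20)\<close>, the factor \<open>100 = 20 * 5\<close> yields
  the error \<open>1 / y ^ 5\<close>.\<close>

definition reps :: "real \<Rightarrow> nat" where
  "reps y = nat \<lceil>100 * ln y\<rceil>"

lemma reps_le: "1 \<le> y \<Longrightarrow> real (reps y) \<le> 100 * ln y + 1"
  unfolding reps_def by (simp add: of_nat_nat)

lemma reps_pos: "1 < y \<Longrightarrow> 0 < reps y"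
  unfolding reps_def by simp

lemma err_power_reps_le:
  assumes "1 \<le> y"
  shows "err ^ reps y \<le> 1 / y ^ 5"
proof -
  have "100 * ln y \<le> reps y" unfolding reps_def by linarith
  have "err ^ reps y \<le> exp (- 1 / 20) ^ reps y"
    using err_le_exp err_pos by (intro power_mono) auto
  also have "\<dots> = exp (- real (reps y) / 20)" by (simp add: exp_of_nat_mult[symmetric])
  also have "\<dots> \<le> exp (- (5 * ln y))" using \<open>100 * ln y \<le> reps y\<close> by simp
  also have "\<dots> = 1 / y ^ 5"
    using assms exp_of_nat_mult[of 5 "ln y"] by (simp add: exp_minus inverse_eq_divide)
  finally show ?thesis .
qed

section \<open>Towers and iterated logarithms\<close>

primrec tower :: "nat \<Rightarrow> nat \<Rightarrow> nat" where
  "tower B 0 = 1"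
| "tower B (Suc j) = B ^ tower B j"

lemma less_self_power: "2 \<le> B \<Longrightarrow> x < B ^ x" for B x :: nat
  using less_exp[of x] power_mono[of 2 B x] by linarith

text \<open>Geometric growth of the towers is all that the sums of costs and of failure
  probabilities need.\<close>

lemma power_le_tower:
  assumes "2 \<le> B"
  shows "B ^ j \<le> tower B j"
proof (induction j)
  case (Suc j)
  have "B * t \<le> B ^ t" if "t \<noteq> 0" for t
  proof -
    obtain m where "t = Suc m" using \<open>t \<noteq> 0\<close> by (cases t) auto
    moreover have "B * Suc m \<le> B * B ^ m"
      using less_self_power[OF assms, of m] by (intro mult_le_mono2) simp
    ultimately show ?thesis by simp
  qed
  moreover have "tower B j \<noteq> 0" using Suc assms by (metis le_zero_eq not_numeral_le_zero power_eq_0_iff)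
  moreover have "B ^ Suc j \<le> B * tower B j" using Suc by simp
  ultimately show ?case using order.trans by (metis tower.simps(2))
qed simp

text \<open>Each step inverts one logarithm, which is legitimate because the earlier iterates are
  positive. The recursion ends at \<open>x <= 0\<close>, below \<open>tower B 0 = 1\<close>.\<close>

lemma le_tower_if_log_iterate_nonpos:
  assumes "(log b ^^ k) x \<le> 0" and "\<forall>i<k. (log b ^^ i) x > 0" and "1 < b" and "b \<le> real B"
  shows "x \<le> real (tower B k)"
  using assms(1,2)
proof (induction k arbitrary: x)
  case (Suc k)
  have "x > 0" using Suc.prems(2) by (metis funpow_0 zero_less_Suc)
  have "log b x \<le> real (tower B k)"
  proof (rule Suc.IH)
    show "(log b ^^ k) (log b x) \<le> 0" using Suc.prems(1) by (simp add: funpow_swap1)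
    show "\<forall>i<k. 0 < (log b ^^ i) (log b x)"
      using Suc.prems(2) by (metis Suc_less_eq comp_apply funpow_Suc_right)
  qed
  then have "x \<le> b powr real (tower B k)"
    using \<open>x > 0\<close> assms(3) by (simp add: log_le_iff)
  also have "\<dots> \<le> real B powr real (tower B k)"
    using assms(3,4) by (intro powr_mono2) auto
  also have "\<dots> = real (tower B (Suc k))"
    using assms(3,4) by (simp add: powr_realpow)
  finally show ?case .
qed simp

(* For b <= sqrt 2 the interval [2, \<infinity>) is invariant under log b. *)
lemma sqrt2_less_if_log_iterate_nonpos:
  assumes "(log b ^^ k) x \<le> 0" and "1 < b" and "2 \<le> x"
  shows "sqrt 2 < b"
proof (rule ccontr)
  assume "\<not> sqrt 2 < b"
  then have "b\<^sup>2 \<le> 2" using assms(2) real_le_rsqrt[of b 2] power_mono[of b "sqrt 2" 2] by simp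
  have "2 \<le> (log b ^^ k) x"
  proof (induction k)
    case (Suc k)
    have "b powr 2 \<le> (log b ^^ k) x" using Suc \<open>b\<^sup>2 \<le> 2\<close> assms(2) by simp
    then show ?case using Suc assms(2) by (simp add: le_log_iff)
  qed (use assms in simp)
  then show False using assms(1) by linarith
qed

section \<open>Schedule for large inputs\<close>

text \<open>The last three clauses serve, in this order: the failure of the samples, the cost of the
  pivot rounds and of the last filter, and the cost of the elements above the pivot over at most
  \<open>g\<close> filters. Here 300 stems from \<open>reps (n ^ 3)\<close>, and 900 from
  \<open>level B n j / \<delta> <= n ^ 9\<close>.\<close>

definition large :: "nat \<Rightarrow> nat \<Rightarrow> bool" where
  "large n g \<longleftrightarrow> 800 \<le> n \<and> 2 \<le> g \<and> g ^ 10 \<le> n \<and> n \<le> 2 * g ^ 10 \<and>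
     exp (- real g) \<le> 1 / (32 * real n ^ 8) \<and>
     30 * real g ^ 8 * (300 * ln n + 1) \<le> n \<and>
     (2 * real g ^ 7 + 1) * g * (900 * ln n + 1) \<le> n"

definition root10 :: "nat \<Rightarrow> nat" where
  "root10 n = nat \<lfloor>real n powr (1/10)\<rfloor>"

lemma eventually_large: "eventually (\<lambda>n. large n (root10 n)) at_top"
proof -
  \<comment> \<open>The rounded root lies between \<open>x powr (1/10) - 1\<close> and
    \<open>x powr (1/10)\<close>; each clause is stated for the unfavourable end, which leaves
    conditions free of rounding.\<close>
  let ?P = "\<lambda>x::real. 800 \<le> x \<and> 3 \<le> x powr (1/10) \<and>
      exp (- (x powr (1/10) - 1)) \<le> 1 / (32 * x ^ 8) \<and> x \<le> 2 * (x powr (1/10) - 1) ^ 10 \<and>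
      30 * (x powr (1/10)) ^ 8 * (300 * ln x + 1) \<le> x \<and>
      (2 * (x powr (1/10)) ^ 7 + 1) * x powr (1/10) * (900 * ln x + 1) \<le> x"
  have "eventually ?P at_top"
    by (intro eventually_conj; real_asymp)
  then have "eventually (\<lambda>n. ?P (real n)) at_top"
    by (rule eventually_compose_filterlim[OF _ filterlim_real_sequentially])
  then show ?thesis
  proof eventually_elim
    case (elim n)
    define y where "y = real n powr (1/10)"
    define g where "g = root10 n"
    have y3: "3 \<le> y" using elim by (simp add: y_def)
    have g: "real g \<le> y" "y - 1 \<le> real g"
      using y3 by (auto simp: g_def root10_def y_def[symmetric])
    have n1: "1 \<le> real n" using elim by simp
    have lnn: "0 \<le> ln (real n)" using n1 by simp
    have "y ^ 10 = real n" using n1 by (simp add: y_def powr_power)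
    have "real (g ^ 10) \<le> y ^ 10" using g by (simp add: power_mono)
    then have 1: "g ^ 10 \<le> n" unfolding \<open>y ^ 10 = real n\<close> by linarith
    have "real n \<le> 2 * (y - 1) ^ 10" using elim by (simp add: y_def)
    also have "\<dots> \<le> 2 * real g ^ 10" using g y3 by (intro mult_left_mono power_mono) auto
    finally have "real n \<le> real (2 * g ^ 10)" by simp
    then have 2: "n \<le> 2 * g ^ 10" by linarith
    have "exp (- real g) \<le> exp (- (y - 1))" using g by simp
    also have "\<dots> \<le> 1 / (32 * real n ^ 8)" using elim by (simp add: y_def)
    finally have 3: "exp (- real g) \<le> 1 / (32 * real n ^ 8)" .
    have "30 * real g ^ 8 * (300 * ln n + 1) \<le> 30 * y ^ 8 * (300 * ln n + 1)"
      using g lnn by (intro mult_right_mono mult_left_mono power_mono) auto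
    also have "\<dots> \<le> n" using elim by (simp add: y_def)
    finally have 4: "30 * real g ^ 8 * (300 * ln n + 1) \<le> n" .
    have "(2 * real g ^ 7 + 1) * g * (900 * ln n + 1) \<le> (2 * y ^ 7 + 1) * y * (900 * ln n + 1)"
      using g lnn y3 by (intro mult_right_mono mult_mono add_right_mono mult_left_mono power_mono) auto
    also have "\<dots> \<le> n" using elim by (simp add: y_def)
    finally have 5: "(2 * real g ^ 7 + 1) * g * (900 * ln n + 1) \<le> n" .
    have "2 \<le> real g" using g y3 by linarith
    then have "2 \<le> g" by simp
    moreover have "800 \<le> n" using elim by simp
    ultimately show ?case using 1 2 3 4 5 by (simp add: large_def g_def)
  qed
qed

(* Without the cap at n, the elements exceeding the pivot could be queried far more than ln n times. *)
definition level :: "nat \<Rightarrow> nat \<Rightarrow> nat \<Rightarrow> nat" where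
  "level B n j = min (tower B j) n"

text \<open>Each filter's cap is the size bound established by the preceding round. Filters become
  idle once the tower has reached \<open>n\<close>: for \<open>b\<close> close to
  \<open>exp (1 / exp 1)\<close> the number \<open>J\<close> may be huge, and every active filter
  pays again for the elements above the pivot.\<close>

definition large_steps :: "nat \<Rightarrow> nat \<Rightarrow> nat \<Rightarrow> nat \<Rightarrow> real \<Rightarrow> nat \<Rightarrow> step" where
  "large_steps n g B J \<delta> i =
    (if i = 0 \<or> i = J + 1 then Pivot (g ^ 4) (reps (real n ^ 3))
     else if i \<le> J then
       if tower B (i - 1) < n
       then Filter (2 * real g ^ 7 + 1 + n / real (level B n (i - 1)) ^ 2) (reps (level B n i / \<delta>))
       else idle
     else if i = J + 2 then Filter (3 * real g ^ 7) (reps (real n ^ 3))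
     else Pivot (5 * g ^ 4) (reps (real n ^ 3)))"

text \<open>The cap at \<open>n\<close> must not spoil the growth. For \<open>j > 0\<close> one has
  \<open>2 ^ (j + 1) <= 4 ^ j <= tower B j < n\<close>, which is why bases start at 4; for
  \<open>j = 0\<close> the hypothesis says \<open>n >= 2\<close>.\<close>

lemma two_power_le_level:
  assumes "4 \<le> B" and "tower B j < n"
  shows "2 ^ Suc j \<le> level B n (Suc j)"
proof -
  have tower: "4 ^ i \<le> tower B i" for i
    using power_le_tower[of B i] power_mono[OF assms(1), of i] assms(1) by linarith
  have "2 ^ Suc j \<le> n"
  proof (cases j)
    case (Suc i)
    have "(2::nat) ^ i \<le> 4 ^ i" by (rule power_mono) auto
    then have "2 ^ Suc j \<le> (4::nat) ^ j" by (simp add: Suc)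
    then show ?thesis using tower[of j] assms(2) by linarith
  qed (use assms in simp)
  moreover have "(2::nat) ^ Suc j \<le> 4 ^ Suc j" by (rule power_mono) auto
  ultimately show ?thesis using tower[of "Suc j"] unfolding level_def by linarith
qed

text \<open>The failure budget is \<open>\<delta> / 8\<close> for the first pivot,
  \<open>\<delta> / 2 ^ (j + 2)\<close> for the filter of round \<open>j + 1\<close>, hence at most
  \<open>\<delta> / 2\<close> for all of them, and \<open>\<delta> / 8\<close> for each of the last
  three rounds.\<close>

lemma fails_large_steps:
  assumes "large n g" and "finite X" and "card X = n" and "p \<in> X" and "4 \<le> B" and "n \<le> tower B J"
    and \<delta>: "1 / real n ^ 8 \<le> \<delta>" "\<delta> \<le> 1"
  shows "fails v adv (large_steps n g B J \<delta>) (X, p) (J + 4) (good v X 0 (3 * real g ^ 4 + 2)) \<le> \<delta>"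
proof -
  let ?steps = "large_steps n g B J \<delta>"
  let ?c0 = "reps (real n ^ 3)"
  let ?t = "2 * real g ^ 7"
  let ?m = "\<lambda>j. ?t + 1 + n / real (level B n j) ^ 2"
  note L = assms(1)[unfolded large_def]
  have n: "800 \<le> real n" using L by simp
  have g2: "2 \<le> real g" using L by simp
  have g10: "real g ^ 10 \<le> n" "n \<le> 2 * real g ^ 10"
    using L by (simp_all flip: of_nat_power of_nat_mult add: numeral_power_le_of_nat_cancel_iff)
  have \<delta>0: "0 < \<delta>" using \<delta> n by (auto intro: less_le_trans[of 0 "1 / real n ^ 8"])
  have c0: "0 < ?c0" using n by (intro reps_pos) simp
  have g8: "real g ^ 8 \<le> n" using g10(1) power_increasing[of 8 10 "real g"] g2 by linarith
  have err: "err ^ ?c0 \<le> 1 / real n ^ 15"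
    using err_power_reps_le[of "real n ^ 3"] n by (simp flip: power_mult)
  \<comment> \<open>One bound for all rounds with \<open>?c0\<close> repetitions: the largest number
    of pairs is \<open>(5 * g ^ 4) ^ 2 = 25 * g ^ 8 <= 25 * n\<close>.\<close>
  have n14: "25 * n * err ^ ?c0 \<le> \<delta> / 16"
  proof -
    have "25 * n * err ^ ?c0 \<le> 25 * n * (1 / real n ^ 15)"
      using err by (intro mult_left_mono) auto
    also have "\<dots> = (25 / real n ^ 6) * (1 / real n ^ 8)"
      using n by (simp add: field_simps eval_nat_numeral)
    also have "\<dots> \<le> (1 / 16) * (1 / real n ^ 8)"
    proof (rule mult_right_mono)
      have "400 \<le> real n ^ 6" using self_le_power[of "real n" 6] n by linarith
      then show "25 / real n ^ 6 \<le> 1 / 16" using n by (simp add: divide_le_eq)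
    qed simp
    also have "\<dots> \<le> \<delta> / 16" using \<delta>(1) by simp
    finally show ?thesis .
  qed
  have expg: "exp (- real g) \<le> \<delta> / 32"
  proof -
    have "exp (- real g) \<le> (1 / real n ^ 8) / 32" using L by simp
    also have "\<dots> \<le> \<delta> / 32" using \<delta>(1) by (rule divide_right_mono) simp
    finally show ?thesis .
  qed
  have g4: "real (g ^ 4) ^ 2 = real g ^ 8" "real (5 * g ^ 4) ^ 2 = 25 * real g ^ 8"
    by (simp_all add: power_mult_distrib flip: power_mult)
  have g8err: "real (g ^ 4) ^ 2 * err ^ ?c0 \<le> \<delta> / 16"
  proof -
    have "real (g ^ 4) ^ 2 * err ^ ?c0 \<le> 25 * n * err ^ ?c0"
      unfolding g4 using err_pos by (intro mult_right_mono) (use g8 in linarith, simp)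
    then show ?thesis using n14 by linarith
  qed

  have base: "fails v adv ?steps (X, p) (Suc 0) (good v X ?t (?m 0)) \<le> \<delta> / 8"
  proof -
    have "fails v adv ?steps (X, p) (Suc 0) (good v X ?t n) \<le> 0 + \<delta> / 8"
    proof (rule fails_Pivot[where s = "g ^ 4" and c = ?c0 and a = n])
      show "fails v adv ?steps (X, p) 0 (good v X n n) \<le> 0"
        using good_initial[OF assms(2,4), of v] by (simp add: assms(3) fails_0)
      have "real g * n \<le> real g * (2 * real g ^ 10)" using g10(2) by (intro mult_left_mono) auto
      also have "\<dots> = ?t * g ^ 4" by (simp add: eval_nat_numeral)
      finally have "real g \<le> ?t * g ^ 4 / n" using n by (simp add: field_simps)
      then have "exp (- ?t * real (g ^ 4) / n) \<le> exp (- real g)" by simp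
      then show "exp (- ?t * real (g ^ 4) / n) + real (g ^ 4) ^ 2 * err ^ ?c0 \<le> \<delta> / 8"
        using expg g8err \<delta>0 by linarith
    qed (use L c0 assms(2) in \<open>auto simp: large_steps_def\<close>)
    then show ?thesis
      by (elim fails_good_mono[OF order.trans]) (use n in \<open>auto simp: level_def\<close>)
  qed

  have filters: "fails v adv ?steps (X, p) (Suc j) (good v X ?t (?m j)) \<le> \<delta> / 8 + \<delta> / 2 * (1 - 1 / 2 ^ j)"
    if "j \<le> J" for j
    using that
  proof (induction j)
    case 0
    then show ?case using base by simp
  next
    case (Suc j)
    then have IH: "fails v adv ?steps (X, p) (Suc j) (good v X ?t (?m j)) \<le> \<delta> / 8 + \<delta> / 2 * (1 - 1 / 2 ^ j)"
      by simp
    show ?case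
    proof (cases "tower B j < n")
      case True
      define \<tau> where "\<tau> = real (level B n (Suc j))"
      have step: "?steps (Suc j) = Filter (?m j) (reps (\<tau> / \<delta>))"
        using True Suc.prems by (simp add: large_steps_def \<tau>_def)
      have "real (2 ^ Suc j) \<le> \<tau>"
        unfolding \<tau>_def of_nat_le_iff using assms(5) True by (intro two_power_le_level) auto
      then have \<tau>: "2 ^ Suc j \<le> \<tau>" by simp
      have \<tau>2: "2 \<le> \<tau>" using \<tau> two_realpow_ge_one[of j] unfolding power_Suc by linarith
      have "fails v adv ?steps (X, p) (Suc (Suc j)) (good v X ?t (?t + 1 + n / \<tau> ^ 2))
          \<le> \<delta> / 8 + \<delta> / 2 * (1 - 1 / 2 ^ j) + \<delta> / 2 ^ (j + 2)"
      proof (rule fails_Filter[OF IH step assms(2)])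
        show "0 < n / \<tau> ^ 2" using n \<tau>2 by simp
        have "\<delta> \<le> \<tau>" using \<delta> \<tau>2 by linarith
        then have e: "err ^ reps (\<tau> / \<delta>) \<le> (\<delta> / \<tau>) ^ 5"
          using err_power_reps_le[of "\<tau> / \<delta>"] \<delta>0 by (simp add: power_divide)
        \<comment> \<open>Markov's inequality loses a factor \<open>\<tau> ^ 2\<close>; the fifth
          power in the error of the votes still leaves \<open>2 * \<delta> / \<tau> ^ 3\<close>,
          which sums geometrically.\<close>
        have "(1 + card X / (n / \<tau> ^ 2)) * err ^ reps (\<tau> / \<delta>) \<le> (1 + \<tau> ^ 2) * (\<delta> / \<tau>) ^ 5"
          using e n by (simp add: assms(3) mult_left_mono)
        also have "\<dots> \<le> (2 * \<tau> ^ 2) * (\<delta> / \<tau> ^ 5)"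
        proof (rule mult_mono)
          show "1 + \<tau> ^ 2 \<le> 2 * \<tau> ^ 2" using \<tau>2 one_le_power[of \<tau> 2] by linarith
          have "\<delta> ^ 5 \<le> \<delta> ^ 1" using \<delta> \<delta>0 by (intro power_decreasing) auto
          then show "(\<delta> / \<tau>) ^ 5 \<le> \<delta> / \<tau> ^ 5"
            using \<tau>2 by (simp add: power_divide divide_right_mono)
        qed (use \<delta>0 \<tau>2 in auto)
        also have "\<dots> = 2 * \<delta> / (\<tau> ^ 2 * \<tau>)" using \<tau>2 by (simp add: field_simps eval_nat_numeral)
        also have "\<dots> \<le> 2 * \<delta> / (2 ^ 2 * 2 ^ Suc j)"
        proof (rule divide_left_mono)
          show "2 ^ 2 * 2 ^ Suc j \<le> \<tau> ^ 2 * \<tau>" using \<tau> \<tau>2 by (intro mult_mono power_mono) auto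
        qed (use \<delta>0 \<tau>2 in auto)
        also have "\<dots> = \<delta> / 2 ^ (j + 2)" by simp
        finally show "(1 + card X / (n / \<tau> ^ 2)) * err ^ reps (\<tau> / \<delta>) \<le> \<delta> / 2 ^ (j + 2)" .
      qed
      also have "\<delta> / 8 + \<delta> / 2 * (1 - 1 / 2 ^ j) + \<delta> / 2 ^ (j + 2) = \<delta> / 8 + \<delta> / 2 * (1 - 1 / 2 ^ Suc j)"
        by (simp add: field_simps)
      finally show ?thesis by (simp add: \<tau>_def)
    next
      case False
      then have "tower B j \<le> tower B (Suc j)" "n \<le> tower B j"
        using less_self_power[of B "tower B j"] assms(5) by auto
      then have level: "level B n (Suc j) = level B n j" by (simp add: level_def)
      have "?steps (Suc j) = idle" using False Suc.prems by (simp add: large_steps_def)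
      note fails_idle[OF IH this assms(2)]
      moreover have "\<delta> / 2 * (1 - 1 / 2 ^ j) \<le> \<delta> / 2 * (1 - 1 / 2 ^ Suc j)"
        using \<delta>0 by (intro mult_left_mono) (auto simp: field_simps)
      ultimately show ?thesis unfolding level by linarith
    qed
  qed

  have g7: "2 \<le> real g ^ 7" using self_le_power[of "real g" 7] g2 by linarith
  have f1: "fails v adv ?steps (X, p) (J + 1) (good v X ?t (3 * real g ^ 7)) \<le> \<delta> * (5 / 8)"
  proof (rule fails_good_mono)
    have "\<delta> / 2 * (1 - 1 / 2 ^ J) \<le> \<delta> / 2 * 1" using \<delta>0 by (intro mult_left_mono) auto
    then show "fails v adv ?steps (X, p) (J + 1) (good v X ?t (?m J)) \<le> \<delta> * (5 / 8)"
      using filters[OF order.refl] unfolding Suc_eq_plus1 by linarith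
    \<comment> \<open>The tower has reached \<open>n\<close>, so the level equals \<open>n\<close>
      and less than one element is left over from the non-exceeding ones.\<close>
    have "n / real (level B n J) ^ 2 \<le> 1"
      using assms(6) n by (simp add: level_def min_absorb2 power2_eq_square)
    then show "?m J \<le> 3 * real g ^ 7" using g7 by linarith
  qed simp
  have f2: "fails v adv ?steps (X, p) (Suc (J + 1)) (good v X (3 * real g ^ 4) (3 * real g ^ 7)) \<le> \<delta> * (5 / 8) + \<delta> / 8"
  proof (rule fails_Pivot[OF f1, where s = "g ^ 4" and c = ?c0])
    have eq: "- (3 * real g ^ 4) * real (g ^ 4) / (3 * real g ^ 7) = - real g"
      using g2 power_add[of "real g" 4 4] power_Suc[of "real g" 7] by simp
    show "exp (- (3 * real g ^ 4) * real (g ^ 4) / (3 * real g ^ 7)) + real (g ^ 4) ^ 2 * err ^ ?c0 \<le> \<delta> / 8"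
      unfolding eq using expg g8err \<delta>0 by linarith
  qed (use L c0 assms(2) in \<open>auto simp: large_steps_def\<close>)
  have f3: "fails v adv ?steps (X, p) (Suc (Suc (J + 1))) (good v X (3 * real g ^ 4) (3 * real g ^ 4 + 1 + 1))
      \<le> \<delta> * (5 / 8) + \<delta> / 8 + \<delta> / 8"
  \<comment> \<open>Here \<open>f = 1\<close>: with about \<open>ln n\<close> votes per element, one
    misjudged element is tolerated.\<close>
  proof (rule fails_Filter[OF f2, where c = ?c0])
    have "(1 + card X / 1) * err ^ ?c0 \<le> 25 * n * err ^ ?c0"
      using err_pos n by (intro mult_right_mono) (auto simp: assms(3))
    then show "(1 + card X / 1) * err ^ ?c0 \<le> \<delta> / 8" using n14 \<delta>0 by linarith
  qed (use assms(2) in \<open>auto simp: large_steps_def\<close>)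
  have f4: "fails v adv ?steps (X, p) (Suc (Suc (Suc (J + 1)))) (good v X 0 (3 * real g ^ 4 + 1 + 1))
      \<le> \<delta> * (5 / 8) + \<delta> / 8 + \<delta> / 8 + \<delta> / 8"
  proof (rule fails_Pivot_exhaustive[OF f3, where s = "5 * g ^ 4" and c = ?c0])
    have "1 \<le> real g ^ 4" using g2 by simp
    then show "3 * real g ^ 4 + 1 + 1 \<le> real (5 * g ^ 4)" by simp
    have "real (5 * g ^ 4) ^ 2 * err ^ ?c0 \<le> 25 * n * err ^ ?c0"
      unfolding g4 using err_pos by (intro mult_right_mono mult_left_mono) (use g8 in auto)
    then show "real (5 * g ^ 4) ^ 2 * err ^ ?c0 \<le> \<delta> / 8" using n14 \<delta>0 by linarith
  qed (use assms(2) c0 in \<open>auto simp: large_steps_def\<close>)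
  have eqs: "Suc (Suc (Suc (J + 1))) = J + 4" "3 * real g ^ 4 + 1 + 1 = 3 * real g ^ 4 + 2"
    "\<delta> * (5 / 8) + \<delta> / 8 + \<delta> / 8 + \<delta> / 8 = \<delta>" by auto
  show ?thesis using f4 unfolding eqs .
qed

section \<open>Query cost of the schedule\<close>

text \<open>The repetition count is bounded in two ways. At most \<open>900 * ln n + 1\<close>, from
  \<open>\<delta> >= 1 / n ^ 8\<close> and the cap at \<open>n\<close>, is charged to the elements
  above the pivot. At most \<open>T * ?W\<close>, from \<open>ln (B ^ T) = T * ln B\<close>, is
  charged to the \<open>n / T ^ 2\<close> others, where it leaves
  \<open>1 / T <= 1 / 2 ^ j\<close>.\<close>

lemma cost_filter_step:
  assumes "2 \<le> B" and "tower B j < n" and \<delta>: "1 / real n ^ 8 \<le> \<delta>" "\<delta> \<le> 1"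
  shows "(2 * real g ^ 7 + 1 + n / real (level B n j) ^ 2) * reps (level B n (Suc j) / \<delta>)
     \<le> (2 * real g ^ 7 + 1) * (900 * ln n + 1) + n * (100 * ln (B / \<delta>) + 1) / 2 ^ j"
proof -
  define T where "T = real (tower B j)"
  define \<tau> where "\<tau> = real (level B n (Suc j))"
  let ?W = "100 * ln (B / \<delta>) + 1"
  define c where "c = real (reps (\<tau> / \<delta>))"
  have n0: "0 < real n" using assms(2) by simp
  have \<delta>0: "0 < \<delta>" using \<delta> n0 by (auto intro: less_le_trans[of 0 "1 / real n ^ 8"])
  have "2 ^ j \<le> B ^ j" using assms(1) by (intro power_mono) auto
  then have "2 ^ j \<le> tower B j" using power_le_tower[OF assms(1), of j] by linarith
  then have T: "2 ^ j \<le> T" unfolding T_def using of_nat_le_iff[of "2 ^ j" "tower B j"] by simp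
  have T1: "1 \<le> T" using T two_realpow_ge_one[of j] by linarith
  have level_j: "real (level B n j) = T" using assms(2) by (simp add: level_def T_def)
  have \<tau>1: "1 \<le> \<tau>" using assms(1,2) by (auto simp: \<tau>_def level_def min_def Suc_le_eq)
  have "\<delta> \<le> \<tau>" using \<tau>1 \<delta> by linarith
  then have c: "c \<le> 100 * (ln \<tau> - ln \<delta>) + 1"
    using reps_le[of "\<tau> / \<delta>"] \<delta>0 \<tau>1 by (simp add: c_def ln_div)
  have "ln (1 / real n ^ 8) \<le> ln \<delta>" using \<delta>(1) \<delta>0 n0 by (subst ln_le_cancel_iff) auto
  then have "- ln \<delta> \<le> 8 * ln n" using n0 by (simp add: ln_div ln_realpow)
  moreover have "\<tau> \<le> n" by (simp add: \<tau>_def level_def)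
  then have "ln \<tau> \<le> ln n" using \<tau>1 n0 by simp
  ultimately have c1: "c \<le> 900 * ln n + 1" using c by argo
  have "\<tau> \<le> real B ^ tower B j" by (simp add: \<tau>_def level_def flip: of_nat_power)
  then have "ln \<tau> \<le> ln (real B ^ tower B j)"
    using \<tau>1 assms(1) by (subst ln_le_cancel_iff) auto
  then have "ln \<tau> \<le> T * ln B" using assms(1) by (simp add: T_def ln_realpow)
  moreover have "0 \<le> - ln \<delta>" using \<delta> \<delta>0 by simp
  then have "- ln \<delta> \<le> T * (- ln \<delta>)" using T1 mult_right_mono[of 1 T "- ln \<delta>"] by simp
  ultimately have "c \<le> 100 * (T * ln B + T * (- ln \<delta>)) + T" using c T1 by argo
  also have "\<dots> = T * ?W" using \<delta>0 assms(1) by (simp add: ln_div algebra_simps)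
  finally have c2: "c \<le> T * ?W" .
  have W0: "0 \<le> ?W" using \<delta> \<delta>0 assms(1) by (simp add: ln_div)
  have "n / T ^ 2 * c \<le> n / T ^ 2 * (T * ?W)" using c2 T1 by (intro mult_left_mono) auto
  also have "\<dots> = n * ?W / T" using T1 by (simp add: power2_eq_square)
  also have "\<dots> \<le> n * ?W / 2 ^ j" using T T1 W0 by (intro divide_left_mono) auto
  finally have "n / T ^ 2 * c \<le> n * ?W / 2 ^ j" .
  moreover have "(2 * real g ^ 7 + 1) * c \<le> (2 * real g ^ 7 + 1) * (900 * ln n + 1)"
    using c1 by (intro mult_left_mono) auto
  ultimately show ?thesis unfolding level_j \<tau>_def[symmetric] c_def[symmetric] by (simp only: distrib_right)
qed

text \<open>From \<open>n ^ 2 <= n ^ 8 <= exp g <= 4 ^ g\<close>. As the towers grow at least like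
  \<open>2 ^ j\<close>, at most \<open>g\<close> filters are active.\<close>

lemma large_le_two_power: "large n g \<Longrightarrow> n \<le> 2 ^ g"
proof -
  assume "large n g"
  then have e: "exp (- real g) \<le> 1 / (32 * real n ^ 8)" and n: "1 \<le> real n" by (auto simp: large_def)
  have "exp (real g) = exp 1 ^ g" by (simp flip: exp_of_nat_mult)
  also have "\<dots> \<le> 4 ^ g" using exp_le by (intro power_mono) auto
  finally have "exp (real g) \<le> 4 ^ g" .
  moreover have "32 * real n ^ 8 \<le> exp (real g)"
    using e n by (simp add: exp_minus field_simps)
  moreover have "0 \<le> real n ^ 8" by simp
  ultimately have "real n ^ 8 \<le> 4 ^ g" by linarith
  moreover have "real n ^ 2 \<le> real n ^ 8" using n by (intro power_increasing) auto
  moreover have "(2 ^ g) ^ 2 = (4::real) ^ g" by (simp add: power2_eq_square flip: power_mult_distrib)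
  ultimately have "real n ^ 2 \<le> (2 ^ g) ^ 2" by linarith
  then have "real n \<le> 2 ^ g" by (rule power2_le_imp_le) simp
  then show ?thesis using of_nat_le_iff[of n "2 ^ g", where 'a = real] by simp
qed

text \<open>The pivots with the last filter, and the elements above the pivot, cost at most
  \<open>n\<close> each; the rest sums to at most \<open>2 * n * ?W\<close>. Since
  \<open>B >= 4 > exp 1\<close>, the logarithm is at least 1 and absorbs the remaining
  \<open>4 * n\<close>.\<close>

lemma cost_large_steps:
  assumes "large n g" and "4 \<le> B" and \<delta>: "1 / real n ^ 8 \<le> \<delta>" "\<delta> \<le> 1"
  shows "(\<Sum>i<J + 4. step_cost (large_steps n g B J \<delta> i)) \<le> 204 * real n * ln (B / \<delta>)"
proof -
  let ?f = "\<lambda>i. step_cost (large_steps n g B J \<delta> i)"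
  let ?c0 = "reps (real n ^ 3)"
  let ?D = "(2 * real g ^ 7 + 1) * (900 * ln n + 1)"
  let ?W = "100 * ln (B / \<delta>) + 1"
  note L = assms(1)[unfolded large_def]
  have n: "800 \<le> real n" using L by simp
  have g2: "2 \<le> real g" using L by simp
  have \<delta>0: "0 < \<delta>" using \<delta> n by (auto intro: less_le_trans[of 0 "1 / real n ^ 8"])
  have "real B \<le> B / \<delta>" using \<delta>(2) \<delta>0 mult_left_le_one_le[of "real B" \<delta>] by (simp add: field_simps)
  then have "exp 1 \<le> B / \<delta>" using exp_le assms(2) by linarith
  then have W: "1 \<le> ln (B / \<delta>)" using assms(2) \<delta>0 by (simp add: ln_ge_iff)
  have D0: "0 \<le> ?D" using n by simp

  have c0: "real ?c0 \<le> 300 * ln n + 1"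
    using reps_le[of "real n ^ 3"] n by (simp add: ln_realpow)
  have rest: "?f 0 + ?f (J + 1) + ?f (J + 2) + ?f (J + 3) \<le> n"
  proof -
    have "real g ^ 7 \<le> real g ^ 8" using g2 by (intro power_increasing) auto
    then have "3 * real g ^ 7 * real ?c0 \<le> 3 * real g ^ 8 * real ?c0"
      by (intro mult_right_mono mult_left_mono) auto
    moreover have "?f 0 = real g ^ 8 * ?c0" "?f (J + 1) = real g ^ 8 * ?c0"
      "?f (J + 2) = 3 * real g ^ 7 * ?c0" "?f (J + 3) = 25 * real g ^ 8 * ?c0"
      by (auto simp: large_steps_def power_mult_distrib simp flip: power_mult)
    ultimately have "?f 0 + ?f (J + 1) + ?f (J + 2) + ?f (J + 3) \<le> 30 * real g ^ 8 * ?c0" by linarith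
    also have "\<dots> \<le> 30 * real g ^ 8 * (300 * ln n + 1)" using c0 by (intro mult_left_mono) auto
    finally show ?thesis using L by linarith
  qed

  have filter: "?f (Suc j) \<le> (if j < g then ?D else 0) + n * ?W * (1 / 2) ^ j" if "j < J" for j
  proof (cases "tower B j < n")
    case True
    have "2 ^ j \<le> B ^ j" using assms(2) by (intro power_mono) auto
    then have "2 ^ j < n" using power_le_tower[of B j] assms(2) True by linarith
    then have "2 ^ j < (2::nat) ^ g" using large_le_two_power[OF assms(1)] by linarith
    then have "j < g" by simp
    have "?f (Suc j) = (2 * real g ^ 7 + 1 + n / real (level B n j) ^ 2) * reps (level B n (Suc j) / \<delta>)"
      using True that by (simp add: large_steps_def)
    also have "\<dots> \<le> ?D + n * ?W / 2 ^ j"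
      using cost_filter_step[OF _ True \<delta>] assms(2) by simp
    finally show ?thesis using \<open>j < g\<close> by (simp add: power_one_over)
  next
    case False
    then have "?f (Suc j) = 0" using that by (simp add: large_steps_def)
    then show ?thesis using D0 W by simp
  qed
  have "(\<Sum>j<J. ?f (Suc j)) \<le> (\<Sum>j<J. (if j < g then ?D else 0) + n * ?W * (1 / 2) ^ j)"
    using filter by (intro sum_mono) auto
  also have "\<dots> = (\<Sum>j<J. if j < g then ?D else 0) + n * ?W * (\<Sum>j<J. (1 / 2) ^ j)"
    by (simp add: sum.distrib sum_distrib_left)
  also have "(\<Sum>j<J. if j < g then ?D else 0) = card ({..<J} \<inter> {..<g}) * ?D"
    by (simp add: sum.If_cases lessThan_def)
  also have "\<dots> \<le> real g * ?D"
    using D0 card_mono[of "{..<g}" "{..<J} \<inter> {..<g}"] by (intro mult_right_mono) auto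
  also have "real g * ?D \<le> n" using L by (simp add: mult_ac)
  also have "(\<Sum>j<J. (1 / 2) ^ j) \<le> (2 :: real)"
    by (subst geometric_sum) (simp_all add: field_simps)
  finally have "(\<Sum>j<J. ?f (Suc j)) \<le> n + n * ?W * 2"
    using W n by (simp add: mult_left_mono)
  moreover have "(\<Sum>i<J + 4. ?f i) = (\<Sum>i<Suc J. ?f i) + ?f (J + 1) + ?f (J + 2) + ?f (J + 3)"
    by (simp add: eval_nat_numeral)
  moreover have "(\<Sum>i<Suc J. ?f i) = ?f 0 + (\<Sum>j<J. ?f (Suc j))"
    by (rule sum.lessThan_Suc_shift)
  ultimately have "(\<Sum>i<J + 4. ?f i) \<le> 2 * n + n * ?W * 2" using rest by linarith
  also have "\<dots> = 4 * (real n * 1) + 200 * (real n * ln (B / \<delta>))" by (simp add: algebra_simps)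
  also have "\<dots> \<le> 4 * (real n * ln (B / \<delta>)) + 200 * (real n * ln (B / \<delta>))"
    by (intro add_right_mono mult_left_mono) (use W in auto)
  finally show ?thesis by simp
qed

section \<open>Small inputs and the choice of the base\<close>

text \<open>For \<open>n = 1\<close> the hypotheses force \<open>\<delta> = 1\<close> and allow any
  \<open>b > 1\<close>, so the query budget can be arbitrarily close to 0 and nothing may be
  asked.\<close>

definition small_steps :: "nat \<Rightarrow> real \<Rightarrow> nat \<Rightarrow> step" where
  "small_steps n \<delta> i = (if i = 0 \<and> n > 1 then Pivot n (reps (real n ^ 2 / \<delta>)) else idle)"

lemma fails_small_steps:
  assumes "finite X" and "card X = n" and "p \<in> X" and "0 < \<delta>" and "\<delta> \<le> 1"
  shows "fails v adv (small_steps n \<delta>) (X, p) (Suc k) (good v X 0 n) \<le> \<delta>"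
proof (induction k)
  case 0
  have init: "fails v adv (small_steps n \<delta>) (X, p) 0 (good v X n n) \<le> 0"
    using good_initial[OF assms(1,3), of v] by (simp add: assms(2) fails_0)
  show ?case
  proof (cases "n > 1")
    case True
    define y where "y = real n ^ 2 / \<delta>"
    have "1 < real n ^ 2" using True by simp
    then have n2: "\<delta> < real n ^ 2" using assms(5) by linarith
    then have y: "1 < y" using assms(4) by (simp add: y_def)
    have "fails v adv (small_steps n \<delta>) (X, p) (Suc 0) (good v X 0 n) \<le> 0 + \<delta>"
    proof (rule fails_Pivot_exhaustive[OF init, where s = n and c = "reps y"])
      have "real n ^ 2 * err ^ reps y \<le> real n ^ 2 * (1 / y ^ 5)"
        using err_power_reps_le[of y] y by (intro mult_left_mono) auto
      also have "\<dots> \<le> real n ^ 2 * (1 / y)"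
        using y self_le_power[of y 5] by (intro mult_left_mono divide_left_mono) auto
      also have "\<dots> = \<delta>" using True by (simp add: y_def)
      finally show "real n ^ 2 * err ^ reps y \<le> \<delta>" .
    qed (use True assms reps_pos[OF y] in \<open>auto simp: small_steps_def y_def\<close>)
    then show ?thesis by simp
  next
    case False
    then have "card X = 1" using assms(1-3) card_gt_0_iff[of X] by (auto simp: not_less le_Suc_eq)
    then have "X = {p}" using assms(3) by (metis card_1_singletonE singletonD)
    then have "good v X 0 n (X, p)" using assms(2) by (simp add: good_def valid_def)
    then have "fails v adv (small_steps n \<delta>) (X, p) 0 (good v X 0 n) \<le> \<delta>"
      using assms(4) by (simp add: fails_0)
    moreover have "small_steps n \<delta> 0 = idle" using False by (simp add: small_steps_def)
    ultimately show ?thesis using assms(1) by (rule fails_idle)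
  qed
next
  case (Suc k)
  moreover have "small_steps n \<delta> (Suc k) = idle" by (simp add: small_steps_def)
  ultimately show ?case using assms(1) by (rule fails_idle)
qed

lemma cost_small_steps:
  "(\<Sum>i<r. step_cost (small_steps n \<delta> i)) \<le> (if n > 1 then real n ^ 2 * reps (real n ^ 2 / \<delta>) else 0)"
proof -
  have "step_cost (small_steps n \<delta> i) = (if i = 0 then if n > 1 then real n ^ 2 * reps (real n ^ 2 / \<delta>) else 0 else 0)" for i
    by (simp add: small_steps_def)
  then show ?thesis by simp
qed

(* The algorithm is not given b; the least admissible integral base is at most a constant multiple of b. *)
definition base :: "nat \<Rightarrow> nat \<Rightarrow> nat" where
  "base n J = (LEAST B. 4 \<le> B \<and> n \<le> tower B J)"

text \<open>The witness for the least base is \<open>b\<close> rounded up and raised to at least 4;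
  \<open>b > 1\<close> gives both \<open>4 <= 4 * b\<close> and
  \<open>b + 1 <= 4 * b\<close>.\<close>

lemma base:
  assumes "log_star b (real n) = enat J" and "1 < b"
  shows "4 \<le> base n J" and "n \<le> tower (base n J) J" and "real (base n J) \<le> 4 * b"
proof -
  let ?P = "\<lambda>B. 4 \<le> B \<and> n \<le> tower B J"
  define B where "B = max 4 (nat \<lceil>b\<rceil>)"
  have "b \<le> real B" unfolding B_def using real_nat_ceiling_ge[of b] by linarith
  then have "real n \<le> real (tower B J)"
    using assms by (intro le_tower_if_log_iterate_nonpos[where b = b]) (auto simp: log_star_eq_enat_iff)
  then have "?P B" by (simp add: B_def)
  then have "?P (base n J)" "base n J \<le> B" unfolding base_def by (rule LeastI, rule Least_le)
  then show "4 \<le> base n J" "n \<le> tower (base n J) J" by auto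
  have "real (nat \<lceil>b\<rceil>) \<le> b + 1" using assms(2) by simp
  then have "real B \<le> 4 * b" using assms(2) unfolding B_def of_nat_max by linarith
  then show "real (base n J) \<le> 4 * b" using \<open>base n J \<le> B\<close> by linarith
qed

section \<open>The algorithm and the theorem\<close>

definition parallel_max :: "nat \<Rightarrow> 'a set \<Rightarrow> nat \<Rightarrow> real \<Rightarrow> 'a algorithm" where
  "parallel_max N X r \<delta> =
     staged_algorithm r
       (if card X < N then small_steps (card X) \<delta>
        else large_steps (card X) (root10 (card X)) (base (card X) (r - 4)) (r - 4) \<delta>)
       (X, SOME x. x \<in> X)"

theorem mainTheorem1:
  "\<exists>(C :: real) (ParallelMax :: 'a set \<Rightarrow> nat \<Rightarrow> real \<Rightarrow> 'a algorithm). C > 0 \<and>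
     (\<forall>(X :: 'a set) (n :: nat) (r :: nat) (\<delta> :: real) (b :: real).
        finite X \<longrightarrow> X \<noteq> {} \<longrightarrow> card X = n \<longrightarrow>
        1 / real n ^ 8 \<le> \<delta> \<longrightarrow> \<delta> \<le> 1 \<longrightarrow>
        b > 1 \<longrightarrow> enat r = log_star b (real n) + 4 \<longrightarrow>
          queries_only (ParallelMax X r \<delta>) X \<and>
          returns_max_with_prob_ge (ParallelMax X r \<delta>) X (1 - \<delta>) \<and>
          rounds (ParallelMax X r \<delta>) = r \<and>
          query_complexity_le (ParallelMax X r \<delta>) (C * real n * ln (b / \<delta>)))"
proof -
  obtain N where N: "\<And>n. n \<ge> N \<Longrightarrow> large n (root10 n)"
    using eventually_large by (auto simp: eventually_at_top_linorder)
  define N' where "N' = real (max N 1)"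
  have ln_N': "0 \<le> ln N'" by (simp add: N'_def)
  \<comment> \<open>Large inputs need \<open>1020 = 204 * 5\<close>, the 5 paying for replacing
    \<open>b\<close> by the integral base. Small ones use \<open>n ^ 2 <= N' * n\<close>, with the
    constant part of the repetition count absorbed by
    \<open>1 <= 4 * ln (b / \<delta>)\<close>.\<close>
  define C where "C = max 1020 (N' * (4 * (200 * ln N' + 1) + 100))"
  show ?thesis
  proof (rule exI[of _ C], rule exI[of _ "parallel_max N"], intro conjI allI impI)
    show "C > 0" by (simp add: C_def less_max_iff_disj)
    fix X :: "'a set" and n r :: nat and \<delta> b :: real
    assume X: "finite X" "X \<noteq> {}" and n: "card X = n" and \<delta>: "1 / real n ^ 8 \<le> \<delta>" "\<delta> \<le> 1"
      and b: "b > 1" and r: "enat r = log_star b (real n) + 4"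
    obtain J where J: "log_star b (real n) = enat J" and rJ: "r = J + 4"
      using r by (cases "log_star b (real n)") (auto simp: numeral_eq_enat)
    have n0: "0 < n" using X n by auto
    have \<delta>0: "0 < \<delta>" using \<delta> n0 by (auto intro: less_le_trans[of 0 "1 / real n ^ 8"])
    define p where "p = (SOME x. x \<in> X)"
    have p: "p \<in> X" unfolding p_def using X by (simp add: some_in_eq)
    then have valid: "valid X (X, p)" by (simp add: valid_def)
    have ln_b: "ln 2 / 2 \<le> ln b" if "n > 1"
    proof -
      have "sqrt 2 < b"
        using J b that by (intro sqrt2_less_if_log_iterate_nonpos[where b = b and k = J and x = n]) (auto simp: log_star_eq_enat_iff)
      then have "ln (sqrt 2) \<le> ln b" using b by (subst ln_le_cancel_iff) auto
      then show ?thesis by (simp add: ln_sqrt)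
    qed
    have ln_\<delta>: "0 \<le> - ln \<delta>" using \<delta> \<delta>0 by simp
    have ln_b\<delta>: "ln (b / \<delta>) = ln b - ln \<delta>" using b \<delta>0 by (simp add: ln_div)
    have ln_nonneg: "0 \<le> ln (b / \<delta>)" unfolding ln_b\<delta> using ln_\<delta> ln_gt_zero[OF b] by linarith
    have C_le: "c * n * ln (b / \<delta>) \<le> C * n * ln (b / \<delta>)" if "c \<le> C" for c
      using that ln_nonneg by (intro mult_right_mono) auto
    show "queries_only (parallel_max N X r \<delta>) X" "rounds (parallel_max N X r \<delta>) = r"
      unfolding parallel_max_def p_def[symmetric] using staged_algorithm_queries(1,2)[OF valid X(1)] by blast+
    show "returns_max_with_prob_ge (parallel_max N X r \<delta>) X (1 - \<delta>)"
    proof (cases "n < N")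
      case True
      then show ?thesis
        using returns_max_if_fails_le[OF fails_small_steps[OF X(1) n p \<delta>0 \<delta>(2), of _ _ "J + 3"] X(1)]
        by (simp add: parallel_max_def p_def[symmetric] n rJ add.commute)
    next
      case False
      then show ?thesis
        using returns_max_if_fails_le[OF fails_large_steps[OF N X(1) n p base(1,2)[OF J b] \<delta>] X(1)]
        by (simp add: parallel_max_def p_def[symmetric] n rJ)
    qed
    show "query_complexity_le (parallel_max N X r \<delta>) (C * real n * ln (b / \<delta>))"
      unfolding parallel_max_def p_def[symmetric]
    proof (rule staged_algorithm_queries(3)[OF valid X(1)], cases "n < N")
      case True
      have "(\<Sum>i<r. step_cost (small_steps n \<delta> i)) \<le> C * n * ln (b / \<delta>)"
      proof (cases "n > 1")
        case n1: True
        have "1 \<le> real n ^ 2" using n1 by simp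
        then have "\<delta> \<le> real n ^ 2" using \<delta>(2) by linarith
        then have "1 \<le> real n ^ 2 / \<delta>" using \<delta>0 by simp
        then have "reps (real n ^ 2 / \<delta>) \<le> 100 * ln (real n ^ 2 / \<delta>) + 1" by (rule reps_le)
        also have "ln (real n ^ 2 / \<delta>) = 2 * ln n - ln \<delta>"
          using n0 \<delta>0 by (simp add: ln_div ln_realpow)
        also have "ln (real n) \<le> ln N'" using True n0 by (simp add: N'_def)
        finally have "real (reps (real n ^ 2 / \<delta>)) \<le> (200 * ln N' + 1) * 1 + 100 * (- ln \<delta>)" by simp
        also have "\<dots> \<le> (200 * ln N' + 1) * (4 * ln (b / \<delta>)) + 100 * ln (b / \<delta>)"
          unfolding ln_b\<delta> using ln_b[OF n1] ln_\<delta> ln2_ge_two_thirds ln_N'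
          by (intro add_mono mult_left_mono) argo+
        finally have reps: "real (reps (real n ^ 2 / \<delta>)) \<le> (4 * (200 * ln N' + 1) + 100) * ln (b / \<delta>)"
          by (simp add: algebra_simps)
        have "(\<Sum>i<r. step_cost (small_steps n \<delta> i)) \<le> real n ^ 2 * reps (real n ^ 2 / \<delta>)"
          using cost_small_steps[of n \<delta> r] n1 by simp
        also have "\<dots> = (real n * real n) * real (reps (real n ^ 2 / \<delta>))" by (simp add: power2_eq_square)
        also have "\<dots> \<le> (N' * n) * ((4 * (200 * ln N' + 1) + 100) * ln (b / \<delta>))"
          using True reps by (intro mult_mono) (auto simp: N'_def)
        also have "\<dots> = (N' * (4 * (200 * ln N' + 1) + 100)) * n * ln (b / \<delta>)" by (simp only: mult_ac)
        also have "\<dots> \<le> C * n * ln (b / \<delta>)" by (rule C_le) (simp add: C_def)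
        finally show ?thesis .
      next
        case False
        then have "(\<Sum>i<r. step_cost (small_steps n \<delta> i)) \<le> 0" using cost_small_steps[of n \<delta> r] by simp
        also have "\<dots> \<le> C * n * ln (b / \<delta>)" using C_le[of 0] by (simp add: C_def)
        finally show ?thesis .
      qed
      then show "(\<Sum>i<r. step_cost ((if card X < N then small_steps (card X) \<delta>
        else large_steps (card X) (root10 (card X)) (base (card X) (r - 4)) (r - 4) \<delta>) i)) \<le> C * n * ln (b / \<delta>)"
        using True n by simp
    next
      case False
      have large: "large n (root10 n)" using False by (intro N) simp
      then have n1: "n > 1" by (simp add: large_def)
      note B = base[OF J b]
      have "(\<Sum>i<r. step_cost (large_steps n (root10 n) (base n J) J \<delta> i)) \<le> 204 * real n * ln (base n J / \<delta>)"
        unfolding rJ by (rule cost_large_steps[OF large B(1) \<delta>])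
      also have "\<dots> \<le> 204 * real n * (5 * ln (b / \<delta>))"
      proof (rule mult_left_mono)
        have "ln (base n J / \<delta>) \<le> ln (4 * (b / \<delta>))"
          using B \<delta>0 b by (subst ln_le_cancel_iff) (auto simp: divide_right_mono)
        \<comment> \<open>The factor 4 between the bases costs \<open>2 * ln 2\<close>, which is at
          most \<open>4 * ln b\<close> because \<open>b > sqrt 2\<close>.\<close>
        also have "\<dots> = 2 * ln 2 + ln (b / \<delta>)"
          using b \<delta>0 ln_realpow[of 2 2] by (simp add: ln_mult ln_div)
        also have "\<dots> \<le> 5 * ln (b / \<delta>)" using ln_b[OF n1] ln_\<delta> unfolding ln_b\<delta> by argo
        finally show "ln (base n J / \<delta>) \<le> 5 * ln (b / \<delta>)" .
      qed simp
      also have "\<dots> = 1020 * real n * ln (b / \<delta>)" by simp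
      also have "\<dots> \<le> C * n * ln (b / \<delta>)" by (rule C_le) (simp add: C_def)
      finally show "(\<Sum>i<r. step_cost ((if card X < N then small_steps (card X) \<delta>
        else large_steps (card X) (root10 (card X)) (base (card X) (r - 4)) (r - 4) \<delta>) i)) \<le> C * n * ln (b / \<delta>)"
        using False n rJ by simp
    qed
  qed
qed

end
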